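(* Let $\mu,\nu\in\mathcal{P}(\mathcal{X})$, $\varepsilon>0$, $c:\mathcal{X}\times\mathcal{X}\to\mathbb{R}_+$ measurable with $\int c\,d\mu\otimes\nu<\infty$, and $K(x,y)=\exp(-c(x,y)/\varepsilon)$. Assume there exist $p>0$ and $\delta>0$ with \[ \lim_{r\to\infty}\frac{\sup_{x,y\in B_r}c(x,y)}{r^p}=0\quad\text{and}\quad\lim_{r\to\infty}\frac{\max\{\mu(B_r^{\mathsf c}),\nu(B_r^{\mathsf c})\}}{\exp(-r^{p+\delta})}=0 . \] Let $\alpha(r)=\exp(-r^{p+\delta/2})$. Then there exists $\underline m>0$ such that for all $m_1=m_2\ge\underline m$, each step of Sinkhorn's algorithm, i.e., the map $\Phi:=S\circ L_{K,\nu}\circ S\circ L_{K^\top,\mu}$, initialized with $g^{(0)}\in\mathcal{G}^{\mu}_{\alpha,\alpha}\setminus\{0\}$, $g^{(0)}\ge0$, is a strict contraction with respect to Hilbert's metric $d_{\mathcal{G}^{\mu}_{\alpha,\alpha}}$ corresponding to $\mathcal{G}^{\mu}_{\alpha,\alpha}$ (that is, there is $\kappa\in(0,1)$ with $d_{\mathcal{G}^{\mu}_{\alpha,\alpha}}(\Phi g,\Phi\tilde g)\le\kappa\, d_{\mathcal{G}^{\mu}_{\alpha,\alpha}}(g,\tilde g)$ for the functions $g,\tilde g$ arising in this way).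
   Context: $\mathcal{X}$ is a Polish space with metric $d_{\mathcal{X}}$, $x_0$ fixed, $B_r=\{x:d_{\mathcal{X}}(x_0,x)\le r\}$, $B_r^{\mathsf c}=\mathcal{X}\setminus B_r$. $L_{K,\nu}f(x)=\int K(x,y)f(y)\,\nu(dy)$, $L_{K^\top,\mu}g(y)=\int K(x,y)g(x)\,\mu(dx)$, and $S(g)=1/g$. Sinkhorn's algorithm (for the entropic optimal transport problem $\inf_{\pi\in\Pi(\mu,\nu)}\int c\,d\pi+\varepsilon H(\pi,\mu\otimes\nu)$, written in terms of the multiplicative dual potential for $\mu$) iterates $g^{(n+1)}=\Phi(g^{(n)})$. For $\rho\in\mathcal{P}(\mathcal{X})$, $0<m_1\le m_2$ and tail functions $\alpha,\tilde\alpha$ (non-increasing, $(0,\infty)\to[0,\infty)$, tending to $0$): $\mathcal{F}^{\rho}_{\alpha,\tilde\alpha}$ is the set of $f\in L^2(\rho)$ with $f\mathbf 1_{B_{m_2}}\ge0$ $\rho$-a.s., $\int_{B_r^{\mathsf c}}f_+\,d\rho\le\alpha(r)\int f\,d\rho$ for all $r\ge m_1$, $\int_{B_r^{\mathsf c}}f_-\,d\rho\le\tilde\alpha(r)\int f\,d\rho$ for all $r\ge m_2$; $\mathcal{G}^{\rho}_{\alpha,\tilde\alpha}=\{g\in L^2(\rho):\int fg\,d\rho\ge0\ \forall f\in\mathcal{F}^{\rho}_{\alpha,\tilde\alpha}\}$. Hilbert's metric for a cone $C$: $f\le_C g$ iff $g-f\in C$; $f\sim_C g$ iff $f\le_C bg$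 and $g\le_C b'f$ for some $b,b'>0$; $M(f,g)=\inf\{b>0:bg-f\in C\}$, $m(f,g)=\sup\{a>0:f-ag\in C\}$; $d_C(f,g)=\log(M/m)$ if $f\sim_C g$, $g\ne0$, and $\infty$ otherwise. *)

theory Defs
  imports "HOL-Probability.Probability"
begin

definition Fcone :: "'a::metric_space measure \<Rightarrow> 'a \<Rightarrow> (real \<Rightarrow> real) \<Rightarrow> (real \<Rightarrow> real)
    \<Rightarrow> real \<Rightarrow> real \<Rightarrow> ('a \<Rightarrow> real) set" where
  "Fcone \<rho> x0 \<alpha> \<alpha>' m1 m2 = {f. f \<in> borel_measurable \<rho> \<and> integrable \<rho> (\<lambda>x. (f x)\<^sup>2)
      \<and> (AE x in \<rho>. x \<in> cball x0 m2 \<longrightarrow> 0 \<le> f x)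
      \<and> (\<forall>r\<ge>m1. (\<integral>x\<in>(- cball x0 r). max (f x) 0 \<partial>\<rho>) \<le> \<alpha> r * (\<integral>x. f x \<partial>\<rho>))
      \<and> (\<forall>r\<ge>m2. (\<integral>x\<in>(- cball x0 r). max (- f x) 0 \<partial>\<rho>) \<le> \<alpha>' r * (\<integral>x. f x \<partial>\<rho>))}"

definition Gcone :: "'a::metric_space measure \<Rightarrow> 'a \<Rightarrow> (real \<Rightarrow> real) \<Rightarrow> (real \<Rightarrow> real)
    \<Rightarrow> real \<Rightarrow> real \<Rightarrow> ('a \<Rightarrow> real) set" where
  "Gcone \<rho> x0 \<alpha> \<alpha>' m1 m2 = {g. g \<in> borel_measurable \<rho> \<and> integrable \<rho> (\<lambda>x. (g x)\<^sup>2)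
      \<and> (\<forall>f\<in>Fcone \<rho> x0 \<alpha> \<alpha>' m1 m2. 0 \<le> (\<integral>x. f x * g x \<partial>\<rho>))}"

text \<open>Hilbert's projective metric for a cone C of functions; "g \<noteq> 0" is understood
  in L^2(rho), i.e. g is not rho-a.e. zero.\<close>
definition cone_le :: "('a \<Rightarrow> real) set \<Rightarrow> ('a \<Rightarrow> real) \<Rightarrow> ('a \<Rightarrow> real) \<Rightarrow> bool" where
  "cone_le C f g \<longleftrightarrow> (\<lambda>x. g x - f x) \<in> C"

definition cone_equiv :: "('a \<Rightarrow> real) set \<Rightarrow> ('a \<Rightarrow> real) \<Rightarrow> ('a \<Rightarrow> real) \<Rightarrow> bool" where
  "cone_equiv C f g \<longleftrightarrow> (\<exists>b>0. cone_le C f (\<lambda>x. b * g x)) \<and> (\<exists>b'>0. cone_le C g (\<lambda>x. b' * f x))"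

definition hilbert_M :: "('a \<Rightarrow> real) set \<Rightarrow> ('a \<Rightarrow> real) \<Rightarrow> ('a \<Rightarrow> real) \<Rightarrow> real" where
  "hilbert_M C f g = Inf {b. b > 0 \<and> (\<lambda>x. b * g x - f x) \<in> C}"

definition hilbert_m :: "('a \<Rightarrow> real) set \<Rightarrow> ('a \<Rightarrow> real) \<Rightarrow> ('a \<Rightarrow> real) \<Rightarrow> real" where
  "hilbert_m C f g = Sup {a. a > 0 \<and> (\<lambda>x. f x - a * g x) \<in> C}"

definition hilbert_dist :: "('a \<Rightarrow> real) set \<Rightarrow> 'a measure \<Rightarrow> ('a \<Rightarrow> real) \<Rightarrow> ('a \<Rightarrow> real) \<Rightarrow> ereal" where
  "hilbert_dist C \<rho> f g =
     (if cone_equiv C f g \<and> \<not> (AE x in \<rho>. g x = 0)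
      then ereal (ln (hilbert_M C f g / hilbert_m C f g)) else \<infinity>)"

definition L_op :: "('a \<Rightarrow> 'a \<Rightarrow> real) \<Rightarrow> 'a measure \<Rightarrow> ('a \<Rightarrow> real) \<Rightarrow> 'a \<Rightarrow> real" where
  "L_op K \<nu> f = (\<lambda>x. \<integral>y. K x y * f y \<partial>\<nu>)"

definition LT_op :: "('a \<Rightarrow> 'a \<Rightarrow> real) \<Rightarrow> 'a measure \<Rightarrow> ('a \<Rightarrow> real) \<Rightarrow> 'a \<Rightarrow> real" where
  "LT_op K \<mu> g = (\<lambda>y. \<integral>x. K x y * g x \<partial>\<mu>)"

definition S_op :: "('a \<Rightarrow> real) \<Rightarrow> 'a \<Rightarrow> real" where
  "S_op h = (\<lambda>x. 1 / h x)"

definition sinkhorn_map :: "('a \<Rightarrow> 'a \<Rightarrow> real) \<Rightarrow> 'a measure \<Rightarrow> 'a measure \<Rightarrow> ('a \<Rightarrow> real) \<Rightarrow> 'a \<Rightarrow> real" where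
  "sinkhorn_map K \<mu> \<nu> = S_op \<circ> L_op K \<nu> \<circ> S_op \<circ> LT_op K \<mu>"

end

theory Submission
  imports Defs "HOL-Real_Asymp.Real_Asymp"
begin

text \<open>Write \<open>B\<close> for the ball of radius \<open>m\<close>. Given nonnegative \<open>g, g'\<close> in the cone \<open>G\<close>, the reciprocals
  in \<open>\<Phi>\<close> turn differences into differences times positive weights: \<open>\<integral> f (b \<Phi> g' - \<Phi> g) d\<mu> =
  \<integral> h (b g' - g) d\<mu>\<close>, where \<open>h\<close> arises from the test function \<open>f\<close> by twice multiplying with a
  weight of growth \<open>exp (2 r^p)\<close> and integrating against the kernel. Since all tails decay faster than
  any power of \<open>exp (r^p)\<close>, for large \<open>m\<close> the function \<open>h\<close> is bounded everywhere and, up to a factor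
  depending only on \<open>m\<close>, comparable on \<open>B\<close> to a positive constant. Hence \<open>h\<close> lies between two multiples of the
  constant function 1 in the order of the cone of test functions, with a ratio of the multiples
  that depends on \<open>m\<close> only. As in Birkhoff's theorem this makes the interval \<open>[m(g, g'), M(g, g')]\<close>
  shrink by a fixed proportion and bounds the diameter of the image of \<open>\<Phi>\<close>, which
  together give a uniform contraction factor.\<close>

section \<open>Preliminaries\<close>

text \<open>The function \<open>h\<close> depends on the test function and on the pair of iterates,
  so there is no fixed linear operator to which Birkhoff's theorem could be applied; the two halves
  of its proof are redone pair by pair. The exponent \<open>p + \<delta> / 2\<close> of
  \<open>\<alpha>\<close> leaves room on both sides. It exceeds \<open>p\<close>, so a test function
  stays integrable after multiplication by the weights. It is below \<open>p + \<delta>\<close>, so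
  the tails of \<open>\<mu>\<close> beat \<open>\<alpha>\<close> by the factor
  \<open>\<tau> = 1 / (256 * E ^ 3)\<close>, and a bounded function that is not too small on the
  ball is itself a test function, whatever signs it takes outside. Nonnegativity of the iterates is
  carried along separately: testing against functions supported in the ball forces it there only,
  while the lower bounds on the kernel integrals use it everywhere.\<close>

lemma ln_affine_interpolation_le:
  fixes t T \<theta> :: real
  assumes "1 \<le> t" "t \<le> T" "0 < \<theta>" "\<theta> < 1"
  shows "ln ((1 - \<theta>) * t + \<theta>) \<le> (1 - \<theta> / T) * ln t"
proof -
  \<comment> \<open>The affine map multiplies \<open>t\<close> by \<open>1 - x\<close>. As
    \<open>t\<close> grows, \<open>x\<close> stays below \<open>\<theta>\<close> while
    \<open>ln t\<close> is unbounded, so the gain is a fixed fraction of \<open>ln t\<close> only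
    below a cap \<open>T\<close>.\<close>
  define x where "x = \<theta> * (1 - 1 / t)"
  have x: "0 \<le> x" "x < 1"
  proof -
    have "x \<le> \<theta> * 1"
      unfolding x_def using assms by (intro mult_left_mono) auto
    then show "x < 1"
      using assms by linarith
    show "0 \<le> x"
      using assms by (simp add: x_def)
  qed
  have eq: "(1 - \<theta>) * t + \<theta> = t * (1 - x)"
    using assms by (simp add: x_def field_simps)
  have "ln (1 - x) \<le> - x"
    using x ln_le_minus_one[of "1 - x"] by simp
  moreover have "\<theta> / T * ln t \<le> x"
  proof -
    have "ln t \<le> t - 1"
      using assms ln_le_minus_one[of t] by simp
    then have "\<theta> / T * ln t \<le> \<theta> / T * (t - 1)"
      using assms by (intro mult_left_mono) auto
    also have "\<dots> \<le> \<theta> / t * (t - 1)"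
      using assms by (intro mult_right_mono divide_left_mono) auto
    also have "\<dots> = x"
      using assms by (simp add: x_def field_simps)
    finally show ?thesis .
  qed
  moreover have "ln (t * (1 - x)) = ln t + ln (1 - x)"
    using x assms by (simp add: ln_mult)
  ultimately show ?thesis
    unfolding eq left_diff_distrib[of 1 "\<theta> / T"] by linarith
qed

text \<open>Read \<open>[a, b]\<close> as a bracket whose ends move inwards by
  \<open>\<theta> * v\<close> and \<open>\<theta> * u\<close>. The worst case is
  \<open>v = 0\<close>, where equality holds: raising the lower end reduces the quotient more than
  lowering the upper end by the same amount.\<close>

lemma ratio_shrink_le:
  fixes a b u v \<theta> :: real
  assumes "0 < a" "a \<le> b" "0 \<le> u" "0 \<le> v" "u + v = b - a" "0 < \<theta>" "\<theta> < 1"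
  shows "(b - \<theta> * u) / (a + \<theta> * v) \<le> (1 - \<theta>) * (b / a) + \<theta>"
proof -
  have pos: "0 < a + \<theta> * v"
    using assms by (simp add: add_pos_nonneg)
  have b: "b = a + u + v"
    using assms by simp
  have "((1 - \<theta>) * b + \<theta> * a) * (a + \<theta> * v) - (b - \<theta> * u) * a = (1 - \<theta>) * \<theta> * (u + v) * v"
    unfolding b by (simp add: algebra_simps)
  also have "\<dots> \<ge> 0"
    using assms by simp
  finally have "(b - \<theta> * u) * a \<le> ((1 - \<theta>) * b + \<theta> * a) * (a + \<theta> * v)"
    by simp
  then have "(b - \<theta> * u) / (a + \<theta> * v) \<le> ((1 - \<theta>) * b + \<theta> * a) / a"
    using assms pos by (subst frac_le_eq) (auto simp: divide_le_0_iff)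
  then show ?thesis
    using assms by (simp add: add_divide_distrib)
qed

section \<open>Integrals over a set, over its complement and against kernels\<close>

lemma integrable_mult_square:
  fixes f g :: "'a \<Rightarrow> real"
  assumes [measurable]: "f \<in> borel_measurable M" "g \<in> borel_measurable M"
    and "integrable M (\<lambda>x. (f x)\<^sup>2)" "integrable M (\<lambda>x. (g x)\<^sup>2)"
  shows "integrable M (\<lambda>x. f x * g x)"
proof (rule Bochner_Integration.integrable_bound)
  show "integrable M (\<lambda>x. (f x)\<^sup>2 + (g x)\<^sup>2)"
    using assms by simp
  have "\<bar>a * b\<bar> \<le> a\<^sup>2 + b\<^sup>2" for a b :: real
  proof -
    have "2 * \<bar>a * b\<bar> \<le> a\<^sup>2 + b\<^sup>2"
      using sum_squares_bound[of "\<bar>a\<bar>" "\<bar>b\<bar>"] by (simp add: abs_mult)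
    then show ?thesis
      by simp
  qed
  then show "AE x in M. norm (f x * g x) \<le> norm ((f x)\<^sup>2 + (g x)\<^sup>2)"
    by auto
qed measurable

lemma set_integrable_Compl:
  fixes f :: "'a \<Rightarrow> real"
  assumes "integrable M f" "B \<in> sets M"
  shows "set_integrable M B f" "set_integrable M (-B) f"
proof -
  show "set_integrable M B f"
    unfolding set_integrable_def using assms by (intro integrable_mult_indicator)
  \<comment> \<open>\<open>- B\<close> is the complement in the type and need not be measurable in
    \<open>M\<close>, so the integrand off \<open>B\<close> is obtained by subtraction.\<close>
  have "integrable M (\<lambda>x. f x - indicator B x *\<^sub>R f x)"
    using assms by (intro Bochner_Integration.integrable_diff integrable_mult_indicator)
  also have "(\<lambda>x. f x - indicator B x *\<^sub>R f x) = (\<lambda>x. indicator (-B) x *\<^sub>R f x)"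
    by (auto simp: indicator_def)
  finally show "set_integrable M (-B) f" by (simp add: set_integrable_def)
qed

lemma integral_split:
  fixes f :: "'a \<Rightarrow> real"
  assumes "integrable M f" "B \<in> sets M"
  shows "(\<integral>x. f x \<partial>M) = (\<integral>x\<in>B. f x \<partial>M) + (\<integral>x\<in>-B. f x \<partial>M)"
proof -
  have "(\<integral>x. f x \<partial>M) = (\<integral>x. indicator B x *\<^sub>R f x + indicator (-B) x *\<^sub>R f x \<partial>M)"
    by (intro Bochner_Integration.integral_cong) (auto simp: indicator_def)
  also have "\<dots> = (\<integral>x\<in>B. f x \<partial>M) + (\<integral>x\<in>-B. f x \<partial>M)"
    using set_integrable_Compl[OF assms] unfolding set_lebesgue_integral_def set_integrable_def
    by (rule Bochner_Integration.integral_add)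
  finally show ?thesis .
qed

text \<open>On \<open>B\<close> the kernel loses at most the factor \<open>E\<close>; off
  \<open>B\<close> the sign of \<open>\<phi>\<close> is unknown, but its absolute mass there is at
  most half of what survives on \<open>B\<close>. Positivity on the ball together with small tails
  is thus turned into a bound that holds everywhere and a matching lower bound on the ball. It is
  applied once for each of the two kernel integrals in \<open>\<Phi>\<close>.\<close>

lemma kernel_integral_bounds:
  fixes \<phi> k :: "'a \<Rightarrow> real"
  assumes \<phi>: "integrable M \<phi>" and B: "B \<in> sets M"
    and k: "k \<in> borel_measurable M" "\<And>x. 0 \<le> k x" "\<And>x. k x \<le> 1"
    and nonneg: "AE x in M. x \<in> B \<longrightarrow> 0 \<le> \<phi> x"
    and tail: "(\<integral>x\<in>-B. \<bar>\<phi> x\<bar> \<partial>M) \<le> (\<integral>x\<in>B. \<phi> x \<partial>M) / (2 * E)"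
    and E: "1 \<le> E"
  shows "\<bar>\<integral>x. k x * \<phi> x \<partial>M\<bar> \<le> 2 * (\<integral>x\<in>B. \<phi> x \<partial>M)"
    and "(\<And>x. x \<in> B \<Longrightarrow> 1 / E \<le> k x) \<Longrightarrow>
      (\<integral>x\<in>B. \<phi> x \<partial>M) / (2 * E) \<le> (\<integral>x. k x * \<phi> x \<partial>M)"
proof -
  let ?A = "\<integral>x\<in>B. \<phi> x \<partial>M"
  have k\<phi>: "integrable M (\<lambda>x. k x * \<phi> x)"
    using \<phi> k by (intro Bochner_Integration.integrable_bound[OF \<phi>])
      (auto simp: abs_mult intro!: mult_left_le_one_le)
  note int = set_integrable_Compl[OF \<phi> B] set_integrable_Compl[OF k\<phi> B]
    set_integrable_Compl[OF integrable_abs[OF \<phi>] B]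
  have "0 \<le> (\<integral>x\<in>-B. \<bar>\<phi> x\<bar> \<partial>M)"
    unfolding set_lebesgue_integral_def by (intro Bochner_Integration.integral_nonneg) auto
  with tail have "0 \<le> ?A / (2 * E)"
    by simp
  then have A: "0 \<le> ?A"
    using E by (simp add: zero_le_divide_iff)
  have "?A / (2 * E) \<le> ?A / 1"
    using A E by (intro divide_left_mono) auto
  then have A2: "?A / (2 * E) \<le> ?A"
    by simp
  have "\<bar>\<integral>x\<in>-B. k x * \<phi> x \<partial>M\<bar> \<le> (\<integral>x\<in>-B. \<bar>\<phi> x\<bar> \<partial>M)"
  proof -
    have "\<bar>\<integral>x\<in>-B. k x * \<phi> x \<partial>M\<bar> \<le> (\<integral>x\<in>-B. \<bar>k x * \<phi> x\<bar> \<partial>M)"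
      using set_integral_norm_bound[OF int(4)] by simp
    also have "\<dots> \<le> (\<integral>x\<in>-B. \<bar>\<phi> x\<bar> \<partial>M)"
      using int k by (intro set_integral_mono set_integrable_abs)
        (auto simp: abs_mult intro!: mult_left_le_one_le)
    finally show ?thesis .
  qed
  note tail' = order_trans[OF this tail]
  have eq: "(\<integral>x. k x * \<phi> x \<partial>M) = (\<integral>x\<in>B. k x * \<phi> x \<partial>M) + (\<integral>x\<in>-B. k x * \<phi> x \<partial>M)"
    by (rule integral_split[OF k\<phi> B])
  have "0 \<le> (\<integral>x\<in>B. k x * \<phi> x \<partial>M)"
    unfolding set_lebesgue_integral_def using nonneg k
    by (intro integral_nonneg_AE) (auto simp: indicator_def elim!: eventually_mono)
  moreover have "(\<integral>x\<in>B. k x * \<phi> x \<partial>M) \<le> ?A"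
    using nonneg k by (intro set_integral_mono_AE int)
      (auto elim!: eventually_mono intro!: mult_left_le_one_le)
  ultimately show "\<bar>\<integral>x. k x * \<phi> x \<partial>M\<bar> \<le> 2 * ?A"
    unfolding eq using tail' A2 by linarith
  assume kE: "\<And>x. x \<in> B \<Longrightarrow> 1 / E \<le> k x"
  have "?A / E = (\<integral>x\<in>B. 1 / E * \<phi> x \<partial>M)"
    by simp
  also have "\<dots> \<le> (\<integral>x\<in>B. k x * \<phi> x \<partial>M)"
  proof (rule set_integral_mono_AE)
    show "set_integrable M B (\<lambda>x. 1 / E * \<phi> x)"
      using int(1) by simp
    show "AE x\<in>B in M. 1 / E * \<phi> x \<le> k x * \<phi> x"
      using nonneg by eventually_elim (metis mult_right_mono kE)
  qed (rule int)
  finally show "?A / (2 * E) \<le> (\<integral>x. k x * \<phi> x \<partial>M)"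
    unfolding eq using tail' by (simp add: abs_le_iff)
qed

lemma kernel_adjoint:
  fixes K :: "'a \<Rightarrow> 'a \<Rightarrow> real"
  assumes "prob_space \<mu>" "prob_space \<nu>"
    and K: "(\<lambda>(x, y). K x y) \<in> borel_measurable (\<mu> \<Otimes>\<^sub>M \<nu>)" "\<And>x y. \<bar>K x y\<bar> \<le> 1"
    and \<phi>: "integrable \<mu> \<phi>" and \<psi>: "integrable \<nu> \<psi>"
  shows "(\<integral>x. \<phi> x * L_op K \<nu> \<psi> x \<partial>\<mu>) = (\<integral>y. \<psi> y * LT_op K \<mu> \<phi> y \<partial>\<nu>)"
proof -
  interpret \<mu>: prob_space \<mu> by fact
  interpret \<nu>: prob_space \<nu> by fact
  interpret pair_sigma_finite \<mu> \<nu> ..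
  note [measurable] = K(1) borel_measurable_integrable[OF \<phi>] borel_measurable_integrable[OF \<psi>]
  have prod: "integrable (\<mu> \<Otimes>\<^sub>M \<nu>) (\<lambda>(x, y). \<phi> x * \<psi> y)"
    using \<phi> \<psi> by (intro Fubini_integrable) (auto simp: abs_mult)
  have "integrable (\<mu> \<Otimes>\<^sub>M \<nu>) (\<lambda>(x, y). \<phi> x * (K x y * \<psi> y))"
  proof (rule Bochner_Integration.integrable_bound[OF prod])
    show "(\<lambda>(x, y). \<phi> x * (K x y * \<psi> y)) \<in> borel_measurable (\<mu> \<Otimes>\<^sub>M \<nu>)"
      by measurable
    show "AE z in \<mu> \<Otimes>\<^sub>M \<nu>. norm (case z of (x, y) \<Rightarrow> \<phi> x * (K x y * \<psi> y))
        \<le> norm (case z of (x, y) \<Rightarrow> \<phi> x * \<psi> y)"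
      using K(2) by (intro AE_I2)
        (auto simp: abs_mult split_beta intro!: mult_left_mono mult_left_le_one_le)
  qed
  from Fubini_integral[OF this] show ?thesis
    unfolding L_op_def LT_op_def
    by (simp flip: integral_mult_right_zero add: mult.left_commute mult.commute)
qed

section \<open>Sinkhorn iterates and the dual cone\<close>

text \<open>In the application \<^term>\<open>e x = exp (max m (dist x0 x) powr p)\<close>: its reciprocal bounds the kernel
  from below against points of the ball, and it bounds the growth of all Sinkhorn iterates. The
  tails of \<^term>\<open>\<mu>\<close>, \<^term>\<open>\<nu>\<close> and of the test functions beat every power of
  \<^term>\<open>E = exp (m powr p)\<close>, and \<^term>\<open>\<tau>\<close> records that the third power suffices.\<close>

locale sinkhorn_cone =
  fixes \<mu> \<nu> :: "'a::polish_space measure" and K :: "'a \<Rightarrow> 'a \<Rightarrow> real" and x0 :: 'a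
    and \<alpha> :: "real \<Rightarrow> real" and m E \<tau> :: real and e :: "'a \<Rightarrow> real"
  assumes prob_mu: "prob_space \<mu>" and prob_nu: "prob_space \<nu>"
    and sets_mu [measurable_cong]: "sets \<mu> = sets borel"
    and sets_nu [measurable_cong]: "sets \<nu> = sets borel"
    and K_meas [measurable]: "(\<lambda>(x, y). K x y) \<in> borel_measurable (borel \<Otimes>\<^sub>M borel)"
    and K_pos: "0 < K x y" and K_le_1: "K x y \<le> 1"
    and E_ge_1: "1 \<le> E" and tau_pos: "0 < \<tau>" and tau_E: "\<tau> * (256 * E ^ 3) \<le> 1"
    and e_meas [measurable]: "e \<in> borel_measurable borel"
    and e_eq: "x \<in> cball x0 m \<Longrightarrow> e x = E" and e_ge: "E \<le> e x"
    and K_lower1: "x \<in> cball x0 m \<Longrightarrow> 1 / e y \<le> K x y"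
    and K_lower2: "y \<in> cball x0 m \<Longrightarrow> 1 / e x \<le> K x y"
    and \<alpha>_nonneg: "m \<le> r \<Longrightarrow> 0 \<le> \<alpha> r" and \<alpha>_le_1: "m \<le> r \<Longrightarrow> \<alpha> r \<le> 1"
    and tail_mu: "m \<le> r \<Longrightarrow> measure \<mu> (- cball x0 r) \<le> \<tau> * \<alpha> r"
    and int_e2_mu: "integrable \<mu> (\<lambda>x. (e x)\<^sup>2)"
    and int_e2_nu: "integrable \<nu> (\<lambda>x. (e x)\<^sup>2)"
    and tail_e2_nu: "(\<integral>x\<in>- cball x0 m. (e x)\<^sup>2 \<partial>\<nu>) \<le> \<tau>"
    and Fcone_int: "f \<in> Fcone \<mu> x0 \<alpha> \<alpha> m m \<Longrightarrow> integrable \<mu> (\<lambda>x. \<bar>f x\<bar> * (e x)\<^sup>2)"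
    and Fcone_tail: "f \<in> Fcone \<mu> x0 \<alpha> \<alpha> m m \<Longrightarrow>
      (\<integral>x\<in>- cball x0 m. \<bar>f x\<bar> * (e x)\<^sup>2 \<partial>\<mu>) \<le> \<tau> * (\<integral>x. f x \<partial>\<mu>)"
begin

sublocale \<mu>: prob_space \<mu> by (rule prob_mu)
sublocale \<nu>: prob_space \<nu> by (rule prob_nu)

abbreviation "B \<equiv> cball x0 m"
abbreviation "F \<equiv> Fcone \<mu> x0 \<alpha> \<alpha> m m"
abbreviation "G \<equiv> Gcone \<mu> x0 \<alpha> \<alpha> m m"
abbreviation "\<Phi> \<equiv> sinkhorn_map K \<mu> \<nu>"
abbreviation "Gpos \<equiv> {g \<in> G. \<not> (AE x in \<mu>. g x = 0) \<and> (AE x in \<mu>. 0 \<le> g x)}"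

lemma space_eq [simp]: "space \<mu> = UNIV" "space \<nu> = UNIV"
  using sets_eq_imp_space_eq[OF sets_mu] sets_eq_imp_space_eq[OF sets_nu] by auto

lemma B_sets [measurable]: "cball x0 r \<in> sets \<mu>" "cball x0 r \<in> sets \<nu>"
  "- cball x0 r \<in> sets \<mu>" "- cball x0 r \<in> sets \<nu>"
  by (auto simp: sets_mu sets_nu)

section \<open>The weight, the tails and the mass of the ball\<close>

lemma e_pos: "0 < e x" "1 \<le> e x" "e x \<le> (e x)\<^sup>2" "1 \<le> (e x)\<^sup>2"
proof -
  show e: "1 \<le> e x" "0 < e x"
    using e_ge[of x] E_ge_1 by auto
  show "e x \<le> (e x)\<^sup>2"
    using e power_increasing[of 1 2 "e x"] by simp
  with e show "1 \<le> (e x)\<^sup>2"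
    by linarith
qed

lemma tau_le: "\<tau> * (256 * E) \<le> 1" "\<tau> * 256 \<le> 1" "\<tau> * (256 * E\<^sup>2) \<le> 1"
proof -
  have "\<tau> * (256 * E ^ n) \<le> 1" if "n \<le> 3" for n
  proof -
    have "\<tau> * (256 * E ^ n) \<le> \<tau> * (256 * E ^ 3)"
      using that E_ge_1 tau_pos by (intro mult_left_mono power_increasing) auto
    with tau_E show ?thesis
      by linarith
  qed
  from this[of 0] this[of 1] this[of 2]
  show "\<tau> * (256 * E) \<le> 1" "\<tau> * 256 \<le> 1" "\<tau> * (256 * E\<^sup>2) \<le> 1"
    by auto
qed

text \<open>Since \<open>1 \<le> (e x)\<^sup>2\<close>, the weighted tail of \<open>\<nu>\<close>
  also controls its plain tail.\<close>

lemma nu_B: "1 / 2 \<le> measure \<nu> B"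
proof -
  have "measure \<nu> (-B) = (\<integral>x\<in>-B. 1 \<partial>\<nu>)"
    by (simp add: set_lebesgue_integral_def)
  also have "\<dots> \<le> (\<integral>x\<in>-B. (e x)\<^sup>2 \<partial>\<nu>)"
    using e_pos by (intro set_integral_mono set_integrable_Compl int_e2_nu) auto
  finally have "measure \<nu> (-B) \<le> \<tau>"
    using tail_e2_nu by linarith
  then show ?thesis
    using \<nu>.prob_compl[of B] tau_le(2) by (simp add: Compl_eq_Diff_UNIV del: Diff_UNIV)
qed

lemma mu_tail: "m \<le> r \<Longrightarrow> measure \<mu> (- cball x0 r) \<le> \<tau>"
  using tail_mu[of r] mult_left_mono[OF \<alpha>_le_1[of r], of \<tau>] tau_pos by linarith

lemma mu_B: "3 / 4 \<le> measure \<mu> B"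
  using \<mu>.prob_compl[of B] tau_le(2) mu_tail[of m] by (simp add: Compl_eq_Diff_UNIV del: Diff_UNIV)

section \<open>Test functions comparable to a constant\<close>

text \<open>The cone allows tails of size \<open>\<alpha> r\<close> times the integral, while a
  function bounded by \<open>b\<close> has tails of at most \<open>b * \<tau> * \<alpha> r\<close>.
  At least three quarters of the mass of \<open>\<mu>\<close> lies on the ball, where the function
  is at least \<open>a\<close>, so the integral is at least \<open>3 * a / 4 - a / 4\<close>, and
  the spare factor \<open>\<tau>\<close> absorbs \<open>b\<close>.\<close>

lemma bounded_in_Fcone:
  assumes h [measurable]: "h \<in> borel_measurable borel" and "0 \<le> a"
    and lower: "\<And>x. x \<in> B \<Longrightarrow> a \<le> h x" and bound: "\<And>x. \<bar>h x\<bar> \<le> b" and ab: "4 * b * \<tau> \<le> a"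
  shows "h \<in> F" and "a / 2 \<le> (\<integral>x. h x \<partial>\<mu>)"
proof -
  have b: "0 \<le> b"
    using bound[of x0] by linarith
  have int: "integrable \<mu> h"
    using bound by (intro \<mu>.integrable_const_bound[where B=b]) auto
  have "(h x)\<^sup>2 \<le> b\<^sup>2" for x
    using bound[of x] b by (simp add: abs_le_square_iff[symmetric])
  then have int2: "integrable \<mu> (\<lambda>x. (h x)\<^sup>2)"
    by (intro \<mu>.integrable_const_bound[where B="b\<^sup>2"]) auto
  have set_bound: "(\<integral>x\<in>- cball x0 r. k x \<partial>\<mu>) \<le> b * measure \<mu> (- cball x0 r)"
    if "integrable \<mu> k" "\<And>x. k x \<le> b" for k r
  proof -
    have "(\<integral>x\<in>- cball x0 r. k x \<partial>\<mu>) \<le> (\<integral>x\<in>- cball x0 r. b \<partial>\<mu>)"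
      using that by (intro set_integral_mono set_integrable_Compl) auto
    then show ?thesis
      by (simp add: set_lebesgue_integral_def mult.commute)
  qed
  have "a * (3 / 4) \<le> a * measure \<mu> B"
    using mu_B assms by (intro mult_left_mono) auto
  also have "\<dots> = (\<integral>x\<in>B. a \<partial>\<mu>)"
    by (simp add: set_lebesgue_integral_def mult.commute)
  also have "\<dots> \<le> (\<integral>x\<in>B. h x \<partial>\<mu>)"
    using int lower by (intro set_integral_mono set_integrable_Compl) auto
  finally have "a * (3 / 4) \<le> (\<integral>x\<in>B. h x \<partial>\<mu>)" .
  moreover have "- (\<integral>x\<in>-B. h x \<partial>\<mu>) \<le> a / 4"
  proof -
    have "- (\<integral>x\<in>-B. h x \<partial>\<mu>) = (\<integral>x\<in>-B. - h x \<partial>\<mu>)"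
      by (simp add: set_lebesgue_integral_def)
    also have "\<dots> \<le> b * measure \<mu> (- B)"
    proof (rule set_bound)
      show "- h x \<le> b" for x
        using bound[of x] by linarith
    qed (use int in auto)
    also have "\<dots> \<le> b * \<tau>"
      using b mu_tail[of m] by (intro mult_left_mono) auto
    finally show ?thesis
      using ab by linarith
  qed
  ultimately show I: "a / 2 \<le> (\<integral>x. h x \<partial>\<mu>)"
    using integral_split[OF int B_sets(1)[of m]] by linarith
  have tail: "(\<integral>x\<in>- cball x0 r. k x \<partial>\<mu>) \<le> \<alpha> r * (\<integral>x. h x \<partial>\<mu>)"
    if "integrable \<mu> k" "\<And>x. k x \<le> b" "m \<le> r" for k r
  proof -
    have "(\<integral>x\<in>- cball x0 r. k x \<partial>\<mu>) \<le> b * (\<tau> * \<alpha> r)"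
      using set_bound[OF that(1,2), of r] mult_left_mono[OF tail_mu[OF that(3)] b] by linarith
    also have "\<dots> = \<alpha> r * (b * \<tau>)"
      by simp
    also have "\<dots> \<le> \<alpha> r * (\<integral>x. h x \<partial>\<mu>)"
    proof (rule mult_left_mono)
      have "0 \<le> b * \<tau>"
        using b tau_pos by simp
      then show "b * \<tau> \<le> (\<integral>x. h x \<partial>\<mu>)"
        using I ab by linarith
    qed (rule \<alpha>_nonneg[OF that(3)])
    finally show ?thesis .
  qed
  have "max (h x) 0 \<le> b" "max (- h x) 0 \<le> b" for x
    using bound[of x] by auto
  then have "\<forall>r\<ge>m. (\<integral>x\<in>- cball x0 r. max (h x) 0 \<partial>\<mu>) \<le> \<alpha> r * (\<integral>x. h x \<partial>\<mu>)"
    "\<forall>r\<ge>m. (\<integral>x\<in>- cball x0 r. max (- h x) 0 \<partial>\<mu>) \<le> \<alpha> r * (\<integral>x. h x \<partial>\<mu>)"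
    using int by (auto intro!: tail)
  moreover have "AE x in \<mu>. x \<in> B \<longrightarrow> 0 \<le> h x"
    using lower assms(2) by (intro AE_I2) (meson order_trans)
  moreover have "h \<in> borel_measurable \<mu>"
    by measurable
  ultimately show "h \<in> F"
    unfolding Fcone_def using int2 by blast
qed

lemma measurable_borel_iff: "borel_measurable \<mu> = borel_measurable borel"
    "borel_measurable \<nu> = borel_measurable borel"
  by (rule measurable_cong_sets[OF sets_mu refl] measurable_cong_sets[OF sets_nu refl])+

lemma GconeD:
  assumes "g \<in> G"
  shows "g \<in> borel_measurable borel" and "integrable \<mu> (\<lambda>x. (g x)\<^sup>2)"
    and "f \<in> F \<Longrightarrow> 0 \<le> (\<integral>x. f x * g x \<partial>\<mu>)"
  using assms unfolding Gcone_def measurable_borel_iff mem_Collect_eq by blast+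

lemma Gcone_integrable:
  assumes "g \<in> G" shows "integrable \<mu> g"
proof (rule \<mu>.square_integrable_imp_integrable)
  show "g \<in> borel_measurable \<mu>"
    using GconeD(1)[OF assms] by (simp only: measurable_borel_iff)
qed (rule GconeD(2)[OF assms])

text \<open>Testing against this function makes the plain integral a positive functional on the dual
  cone, the scale in which its elements are compared.\<close>

lemma one_in_Fcone: "(\<lambda>x. 1) \<in> F"
  by (rule bounded_in_Fcone(1)[of _ 1 1]) (use tau_le(2) tau_pos in auto)

lemma Gcone_integral_nonneg: "g \<in> G \<Longrightarrow> 0 \<le> (\<integral>x. g x \<partial>\<mu>)"
  using GconeD(3)[OF _ one_in_Fcone] by simp

text \<open>Both \<open>h - A / (4 * E)\<close> and \<open>3 * A - h\<close> are bounded with a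
  positive margin on the ball, hence test functions. In the order of the test cone \<open>h\<close>
  therefore lies between two constants with quotient \<open>12 * E\<close>, the number that governs
  the contraction.\<close>

lemma bounded_pairing:
  assumes h [measurable]: "h \<in> borel_measurable borel" and "0 \<le> A"
    and lower: "\<And>x. x \<in> B \<Longrightarrow> A / (2 * E) \<le> h x" and bound: "\<And>x. \<bar>h x\<bar> \<le> 2 * A"
    and u: "u \<in> G"
  shows "A / (4 * E) * (\<integral>x. u x \<partial>\<mu>) \<le> (\<integral>x. u x * h x \<partial>\<mu>)"
    and "(\<integral>x. u x * h x \<partial>\<mu>) \<le> 3 * A * (\<integral>x. u x \<partial>\<mu>)"
proof -
  have "A / (4 * E) \<le> A / 1"
    using E_ge_1 \<open>0 \<le> A\<close> by (intro divide_left_mono) auto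
  then have Eb: "A / (4 * E) \<le> A" "A / (2 * E) = A / (4 * E) + A / (4 * E)" "0 \<le> A / (4 * E)"
    using E_ge_1 \<open>0 \<le> A\<close> by simp_all
  have uh: "integrable \<mu> (\<lambda>x. u x * h x)"
  proof (rule Bochner_Integration.integrable_bound)
    show "integrable \<mu> (\<lambda>x. 2 * A * u x)"
      using Gcone_integrable[OF u] by simp
    have [measurable]: "u \<in> borel_measurable borel"
      using u by (rule GconeD(1))
    show "(\<lambda>x. u x * h x) \<in> borel_measurable \<mu>"
      by measurable
    have "\<bar>u x * h x\<bar> \<le> \<bar>2 * A * u x\<bar>" for x
      using mult_right_mono[OF bound[of x], of "\<bar>u x\<bar>"] \<open>0 \<le> A\<close>
      by (simp add: abs_mult mult.commute)
    then show "AE x in \<mu>. norm (u x * h x) \<le> norm (2 * A * u x)"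
      by simp
  qed
  have "A / (4 * E) * (256 * E * \<tau>) \<le> A / (4 * E) * 1"
    using Eb tau_le(1) by (intro mult_left_mono) (simp_all add: mult.commute)
  moreover have "A / (4 * E) * (256 * E * \<tau>) = 64 * A * \<tau>"
    using E_ge_1 by simp
  moreover have "0 \<le> A * \<tau>"
    using \<open>0 \<le> A\<close> tau_pos by simp
  ultimately have small: "64 * (A * \<tau>) \<le> A / (4 * E)" "0 \<le> A * \<tau>"
    by auto
  \<comment> \<open>Only half of the lower bound \<open>A / (2 * E)\<close> is subtracted; the other
    half remains as the margin on the ball that membership requires.\<close>
  have "(\<lambda>x. h x - A / (4 * E)) \<in> F"
  proof (rule bounded_in_Fcone(1))
    show "\<bar>h x - A / (4 * E)\<bar> \<le> 3 * A" for x
      using Eb bound[of x] by linarith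
    show "4 * (3 * A) * \<tau> \<le> A / (4 * E)"
      using small by linarith
    show "A / (4 * E) \<le> h x - A / (4 * E)" if "x \<in> B" for x
      using lower[OF that] Eb by linarith
  qed (use Eb in auto)
  from u this have "0 \<le> (\<integral>x. (h x - A / (4 * E)) * u x \<partial>\<mu>)"
    by (rule GconeD(3))
  also have "\<dots> = (\<integral>x. u x * h x - A / (4 * E) * u x \<partial>\<mu>)"
    by (intro Bochner_Integration.integral_cong) (auto simp: algebra_simps)
  also have "\<dots> = (\<integral>x. u x * h x \<partial>\<mu>) - A / (4 * E) * (\<integral>x. u x \<partial>\<mu>)"
    using uh Gcone_integrable[OF u] by simp
  finally show "A / (4 * E) * (\<integral>x. u x \<partial>\<mu>) \<le> (\<integral>x. u x * h x \<partial>\<mu>)"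
    by simp
  have "(\<lambda>x. 3 * A - h x) \<in> F"
  proof (rule bounded_in_Fcone(1))
    show "\<bar>3 * A - h x\<bar> \<le> 5 * A" for x
      using bound[of x] \<open>0 \<le> A\<close> by linarith
    show "4 * (5 * A) * \<tau> \<le> A"
      using small Eb by linarith
    show "A \<le> 3 * A - h x" for x
      using bound[of x] by linarith
  qed (use \<open>0 \<le> A\<close> in auto)
  from u this have "0 \<le> (\<integral>x. (3 * A - h x) * u x \<partial>\<mu>)"
    by (rule GconeD(3))
  also have "\<dots> = (\<integral>x. 3 * A * u x - u x * h x \<partial>\<mu>)"
    by (intro Bochner_Integration.integral_cong) (auto simp: algebra_simps)
  also have "\<dots> = 3 * A * (\<integral>x. u x \<partial>\<mu>) - (\<integral>x. u x * h x \<partial>\<mu>)"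
    using uh Gcone_integrable[OF u] by simp
  finally show "(\<integral>x. u x * h x \<partial>\<mu>) \<le> 3 * A * (\<integral>x. u x \<partial>\<mu>)"
    by simp
qed

section \<open>One Sinkhorn step: pointwise bounds\<close>

lemma K_section [measurable]: "(\<lambda>x. K x y) \<in> borel_measurable borel" "(\<lambda>y. K x y) \<in> borel_measurable borel"
proof -
  have "(\<lambda>x. (\<lambda>(x, y). K x y) (x, y)) \<in> borel_measurable borel"
    by (rule measurable_compose[OF _ K_meas]) measurable
  then show "(\<lambda>x. K x y) \<in> borel_measurable borel"
    by simp
  have "(\<lambda>y. (\<lambda>(x, y). K x y) (x, y)) \<in> borel_measurable borel"
    by (rule measurable_compose[OF _ K_meas]) measurable
  then show "(\<lambda>y. K x y) \<in> borel_measurable borel"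
    by simp
qed

lemma L_measurable [measurable]:
  assumes [measurable]: "f \<in> borel_measurable borel"
  shows "LT_op K \<mu> f \<in> borel_measurable borel" "L_op K \<nu> f \<in> borel_measurable borel"
  unfolding LT_op_def L_op_def by measurable

lemma S_measurable [measurable]:
  "f \<in> borel_measurable borel \<Longrightarrow> S_op f \<in> borel_measurable borel"
  unfolding S_op_def by measurable

lemma kernel_integrable:
  "integrable \<mu> f \<Longrightarrow> integrable \<mu> (\<lambda>x. K x y * f x)"
  "integrable \<nu> f \<Longrightarrow> integrable \<nu> (\<lambda>y. K x y * f y)"
proof -
  assume f: "integrable \<mu> f"
  then have [measurable]: "f \<in> borel_measurable \<mu>"
    by auto
  show "integrable \<mu> (\<lambda>x. K x y * f x)"
    using K_pos K_le_1
    by (intro Bochner_Integration.integrable_bound[OF f])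
      (auto simp: abs_mult less_imp_le intro!: mult_left_le_one_le)
next
  assume f: "integrable \<nu> f"
  then have [measurable]: "f \<in> borel_measurable \<nu>"
    by auto
  show "integrable \<nu> (\<lambda>y. K x y * f y)"
    using K_pos K_le_1
    by (intro Bochner_Integration.integrable_bound[OF f])
      (auto simp: abs_mult less_imp_le intro!: mult_left_le_one_le)
qed

lemma int_e_nu: "integrable \<nu> e" "(\<integral>x. e x \<partial>\<nu>) \<le> 2 * E"
proof -
  show int: "integrable \<nu> e"
    using e_pos by (intro Bochner_Integration.integrable_bound[OF int_e2_nu]) (auto simp: less_imp_le)
  have "(\<integral>x\<in>B. e x \<partial>\<nu>) = (\<integral>x\<in>B. E \<partial>\<nu>)"
    unfolding set_lebesgue_integral_def
    by (intro Bochner_Integration.integral_cong) (auto simp: indicator_def e_eq)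
  also have "\<dots> \<le> E"
    using E_ge_1 by (simp add: set_lebesgue_integral_def mult_left_le_one_le)
  finally have "(\<integral>x\<in>B. e x \<partial>\<nu>) \<le> E" .
  moreover have "(\<integral>x\<in>-B. e x \<partial>\<nu>) \<le> (\<integral>x\<in>-B. (e x)\<^sup>2 \<partial>\<nu>)"
    using e_pos by (intro set_integral_mono set_integrable_Compl int int_e2_nu) auto
  ultimately show "(\<integral>x. e x \<partial>\<nu>) \<le> 2 * E"
    using integral_split[OF int B_sets(2)[of m]] tail_e2_nu tau_le(2) tau_pos E_ge_1 by linarith
qed

text \<open>A nonnegative function with vanishing integral vanishes almost everywhere. For the
  second bound, the function equal to 1 on the ball and to -1 outside is a test function, so duality
  itself says that at least half of the integral of \<open>g\<close> comes from the ball.\<close>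

lemma Gpos_integral:
  assumes "g \<in> Gpos"
  shows "0 < (\<integral>x. g x \<partial>\<mu>)" and "(\<integral>x. g x \<partial>\<mu>) \<le> 2 * (\<integral>x\<in>B. g x \<partial>\<mu>)"
proof -
  have g: "g \<in> G" "AE x in \<mu>. 0 \<le> g x" "\<not> (AE x in \<mu>. g x = 0)"
    using assms by auto
  note int = Gcone_integrable[OF g(1)]
  have "(\<integral>x. g x \<partial>\<mu>) \<noteq> 0"
    using integral_nonneg_eq_0_iff_AE[OF int g(2)] g(3) by simp
  then show "0 < (\<integral>x. g x \<partial>\<mu>)"
    using Gcone_integral_nonneg[OF g(1)] by simp
  have [measurable]: "B \<in> sets borel"
    by simp
  have "(\<lambda>x. 2 * indicator B x - 1) \<in> F"
    by (rule bounded_in_Fcone(1)[of _ 1 1]) (use tau_le(2) tau_pos in \<open>auto simp: indicator_def\<close>)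
  from GconeD(3)[OF g(1) this] have "0 \<le> (\<integral>x. (2 * indicator B x - 1) * g x \<partial>\<mu>)" .
  also have "\<dots> = (\<integral>x. 2 * (indicator B x *\<^sub>R g x) - g x \<partial>\<mu>)"
    by (intro Bochner_Integration.integral_cong) (simp_all add: algebra_simps)
  also have "\<dots> = 2 * (\<integral>x\<in>B. g x \<partial>\<mu>) - (\<integral>x. g x \<partial>\<mu>)"
    using int set_integrable_Compl(1)[OF int B_sets(1)[of m]]
    by (simp add: set_lebesgue_integral_def set_integrable_def)
  finally show "(\<integral>x. g x \<partial>\<mu>) \<le> 2 * (\<integral>x\<in>B. g x \<partial>\<mu>)"
    by simp
qed

text \<open>For the lower bound the ball alone is enough: there the kernel is at least
  \<open>1 / e y\<close> and \<open>g\<close> has at least half of its integral.\<close>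

lemma LT_bounds:
  assumes "g \<in> Gpos"
  defines "s \<equiv> \<integral>x. g x \<partial>\<mu>"
  shows "s / (2 * e y) \<le> LT_op K \<mu> g y" and "LT_op K \<mu> g y \<le> s"
proof -
  have g: "g \<in> G" "AE x in \<mu>. 0 \<le> g x"
    using assms by auto
  note int = Gcone_integrable[OF g(1)]
  have "s / (2 * e y) \<le> (\<integral>x\<in>B. g x \<partial>\<mu>) / e y"
    using Gpos_integral(2)[OF assms(1)] e_pos[of y] by (simp add: s_def field_simps)
  also have "\<dots> = (\<integral>x\<in>B. 1 / e y * g x \<partial>\<mu>)"
    by simp
  also have "\<dots> \<le> (\<integral>x. K x y * g x \<partial>\<mu>)"
    unfolding set_lebesgue_integral_def
  proof (rule integral_mono_AE)
    have "set_integrable \<mu> B (\<lambda>x. 1 / e y * g x)"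
      using int by (intro set_integrable_Compl) simp_all
    then show "integrable \<mu> (\<lambda>x. indicat_real B x *\<^sub>R (1 / e y * g x))"
      by (simp add: set_integrable_def)
    show "AE x in \<mu>. indicat_real B x *\<^sub>R (1 / e y * g x) \<le> K x y * g x"
      using g(2)
    proof eventually_elim
      case (elim x)
      then show ?case
        using mult_right_mono[OF K_lower1[of x y], of "g x"] K_pos[of x y]
        by (cases "x \<in> B") (simp_all add: less_imp_le del: mem_cball)
    qed
  qed (rule kernel_integrable(1)[OF int])
  finally show "s / (2 * e y) \<le> LT_op K \<mu> g y"
    by (simp add: LT_op_def)
  show "LT_op K \<mu> g y \<le> s"
    unfolding LT_op_def s_def
  proof (rule integral_mono_AE)
    show "AE x in \<mu>. K x y * g x \<le> g x"
      using g(2) by eventually_elim (use K_pos K_le_1 in \<open>simp add: less_imp_le mult_left_le_one_le\<close>)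
  qed (use kernel_integrable(1)[OF int] int in auto)
qed

lemma S_LT_bounds:
  assumes "g \<in> Gpos"
  defines "s \<equiv> \<integral>x. g x \<partial>\<mu>" and "k \<equiv> S_op (LT_op K \<mu> g)"
  shows "1 / s \<le> k y" and "k y \<le> 2 * e y / s" and "integrable \<nu> k"
proof -
  have s: "0 < s"
    using Gpos_integral assms by auto
  note b = LT_bounds[OF assms(1), folded s_def, of y for y]
  have pos: "0 < s / (2 * e y)" for y
    using s e_pos[of y] by simp
  have low: "1 / s \<le> k y" for y
    unfolding k_def S_op_def using order.strict_trans2[OF pos b(1)] b(2) s
    by (intro divide_left_mono) simp_all
  then show "1 / s \<le> k y" .
  have up: "k y \<le> 2 * e y / s" for y
  proof -
    have "k y \<le> 1 / (s / (2 * e y))"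
      unfolding k_def S_op_def
      by (intro divide_left_mono mult_pos_pos b(1) order.strict_trans2[OF pos b(1)] pos) simp
    then show ?thesis
      by simp
  qed
  then show "k y \<le> 2 * e y / s" .
  have [measurable]: "g \<in> borel_measurable borel"
    using assms GconeD(1) by blast
  have [measurable]: "k \<in> borel_measurable borel"
    unfolding k_def by measurable
  show "integrable \<nu> k"
  proof (rule Bochner_Integration.integrable_bound)
    show "integrable \<nu> (\<lambda>y. 2 * e y / s)"
      using int_e_nu by simp
    have "norm (k y) \<le> norm (2 * e y / s)" for y
    proof -
      have "0 < 1 / s"
        using s by simp
      then have "0 < k y"
        using low[of y] by linarith
      then show ?thesis
        using up[of y] unfolding real_norm_def by linarith
    qed
    then show "AE y in \<nu>. norm (k y) \<le> norm (2 * e y / s)"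
      by simp
  qed measurable
qed

text \<open>The factor \<open>1 / 2\<close> is the mass of the ball under \<open>\<nu>\<close>. In
  the upper bound the growth of the reciprocal in \<open>y\<close> is integrated out, so only the
  constant \<open>E\<close> is left of it and growth does not accumulate from one half-step to the
  next.\<close>

lemma L_bounds:
  assumes "g \<in> Gpos"
  defines "s \<equiv> \<integral>x. g x \<partial>\<mu>" and "l \<equiv> L_op K \<nu> (S_op (LT_op K \<mu> g))"
  shows "1 / (2 * s * e x) \<le> l x" and "l x \<le> 4 * E / s"
proof -
  have s: "0 < s"
    using Gpos_integral assms by auto
  let ?k = "S_op (LT_op K \<mu> g)"
  note k = S_LT_bounds[OF assms(1), folded s_def]
  have k0: "0 \<le> ?k y" for y
    using k(1)[of y] s divide_pos_pos[of 1 s] by linarith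
  have "1 / (2 * s * e x) = 1 / e x * (1 / s) * (1 / 2)"
    by simp
  also have "\<dots> \<le> 1 / e x * (1 / s) * measure \<nu> B"
    using nu_B s e_pos[of x] by (intro mult_left_mono) auto
  also have "\<dots> = (\<integral>y\<in>B. 1 / e x * (1 / s) \<partial>\<nu>)"
    by (simp add: set_lebesgue_integral_def)
  also have "\<dots> \<le> (\<integral>y. K x y * ?k y \<partial>\<nu>)"
    unfolding set_lebesgue_integral_def
  proof (rule integral_mono)
    show "integrable \<nu> (\<lambda>y. indicat_real B y *\<^sub>R (1 / e x * (1 / s)))"
      by (intro integrable_mult_indicator) simp_all
    show "integrable \<nu> (\<lambda>y. K x y * ?k y)"
      using k(3) by (rule kernel_integrable(2))
    show "indicat_real B y *\<^sub>R (1 / e x * (1 / s)) \<le> K x y * ?k y" for y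
    proof (cases "y \<in> B")
      case True
      then show ?thesis
        using mult_mono[OF K_lower2[OF True, of x] k(1)[of y]] K_pos[of x y] s
        by (simp add: less_imp_le)
    qed (use k0[of y] K_pos[of x y] in simp)
  qed
  finally show "1 / (2 * s * e x) \<le> l x"
    by (simp add: l_def L_op_def)
  have "l x \<le> (\<integral>y. 2 * e y / s \<partial>\<nu>)"
    unfolding l_def L_op_def
  proof (rule integral_mono)
    show "integrable \<nu> (\<lambda>y. K x y * ?k y)"
      using k(3) by (rule kernel_integrable(2))
    show "integrable \<nu> (\<lambda>y. 2 * e y / s)"
      using int_e_nu by simp
    show "K x y * ?k y \<le> 2 * e y / s" for y
      using mult_left_le_one_le[OF k0[of y], of "K x y"] k(2)[of y] K_pos[of x y] K_le_1[of x y]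
      by (simp add: less_imp_le)
  qed
  also have "\<dots> = 2 * (\<integral>y. e y \<partial>\<nu>) / s"
    by simp
  also have "\<dots> \<le> 2 * (2 * E) / s"
    using int_e_nu(2) s by (intro divide_right_mono) auto
  finally show "l x \<le> 4 * E / s"
    by simp
qed

lemma sinkhorn_map_eq: "\<Phi> g x = 1 / L_op K \<nu> (S_op (LT_op K \<mu> g)) x"
  by (simp add: sinkhorn_map_def S_op_def)

text \<open>The scale \<open>s\<close> is all that these bounds retain of the input. Growth of first
  order in \<open>e\<close> is what lets the product of two images serve as a weight of order
  \<open>(e x)\<^sup>2\<close>.\<close>

lemma sinkhorn_bounds:
  assumes "g \<in> Gpos"
  defines "s \<equiv> \<integral>x. g x \<partial>\<mu>"
  shows "s / (4 * E) \<le> \<Phi> g x" and "\<Phi> g x \<le> 2 * s * e x" and "\<Phi> g \<in> borel_measurable borel"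
proof -
  have s: "0 < s"
    using Gpos_integral assms by auto
  note l = L_bounds[OF assms(1), folded s_def, of x]
  have pos: "0 < 1 / (2 * s * e x)"
    using s e_pos[of x] by simp
  have "1 / (4 * E / s) \<le> \<Phi> g x"
    unfolding sinkhorn_map_eq using order.strict_trans2[OF pos l(1)] l(2) s E_ge_1
    by (intro divide_left_mono) simp_all
  then show "s / (4 * E) \<le> \<Phi> g x"
    by simp
  have "\<Phi> g x \<le> 1 / (1 / (2 * s * e x))"
    unfolding sinkhorn_map_eq
    by (intro divide_left_mono mult_pos_pos l(1) order.strict_trans2[OF pos l(1)] pos) simp
  then show "\<Phi> g x \<le> 2 * s * e x"
    by simp
  have [measurable]: "g \<in> borel_measurable borel"
    using assms GconeD(1) by blast
  show "\<Phi> g \<in> borel_measurable borel"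
    unfolding sinkhorn_map_def comp_def by measurable
qed

lemma sinkhorn_pos:
  assumes "g \<in> Gpos"
  shows "0 < \<Phi> g x"
proof -
  have "0 < (\<integral>x. g x \<partial>\<mu>) / (4 * E)"
    by (intro divide_pos_pos Gpos_integral(1)[OF assms]) (use E_ge_1 in simp)
  also have "\<dots> \<le> \<Phi> g x"
    by (rule sinkhorn_bounds(1)[OF assms])
  finally show ?thesis .
qed

lemma sinkhorn_square_integrable:
  assumes "g \<in> Gpos"
  shows "integrable \<mu> (\<lambda>x. (\<Phi> g x)\<^sup>2)"
proof (rule Bochner_Integration.integrable_bound)
  let ?s = "\<integral>x. g x \<partial>\<mu>"
  have [measurable]: "\<Phi> g \<in> borel_measurable borel"
    by (rule sinkhorn_bounds(3)[OF assms])
  show "integrable \<mu> (\<lambda>x. (2 * ?s)\<^sup>2 * (e x)\<^sup>2)"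
    using int_e2_mu by simp
  show "(\<lambda>x. (\<Phi> g x)\<^sup>2) \<in> borel_measurable \<mu>"
    by measurable
  have "(\<Phi> g x)\<^sup>2 \<le> (2 * ?s * e x)\<^sup>2" for x
    using sinkhorn_bounds(2)[OF assms, of x] sinkhorn_pos[OF assms, of x]
    by (intro power_mono) simp_all
  then show "AE x in \<mu>. norm ((\<Phi> g x)\<^sup>2) \<le> norm ((2 * ?s)\<^sup>2 * (e x)\<^sup>2)"
    by (simp add: power_mult_distrib)
qed

section \<open>Weighted test functions and the invariance of the nonnegative dual elements\<close>

lemma FconeD:
  assumes f: "f \<in> F"
  shows "f \<in> borel_measurable borel" and "integrable \<mu> (\<lambda>x. (f x)\<^sup>2)" and "integrable \<mu> f"
    and "AE x in \<mu>. x \<in> B \<longrightarrow> 0 \<le> f x"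
proof -
  show 1: "f \<in> borel_measurable borel" "integrable \<mu> (\<lambda>x. (f x)\<^sup>2)"
    "AE x in \<mu>. x \<in> B \<longrightarrow> 0 \<le> f x"
    using f unfolding Fcone_def measurable_borel_iff mem_Collect_eq
    by - (elim conjE, assumption)+
  show "integrable \<mu> f"
  proof (rule \<mu>.square_integrable_imp_integrable)
    show "f \<in> borel_measurable \<mu>"
      using 1(1) by (simp only: measurable_borel_iff)
  qed (rule 1(2))
qed

text \<open>The ball keeps at least half of the integral of \<open>f\<close>, and there
  \<open>f\<close> is nonnegative and the weight at least \<open>a\<close>; off the ball the growth
  of \<open>w\<close> is what the weighted tail bound of the test cone absorbs. The weight will be
  one image under \<open>\<Phi>\<close>, or the product of two.\<close>

lemma Fcone_weighted:
  assumes f: "f \<in> F" and w [measurable]: "w \<in> borel_measurable borel"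
    and "0 \<le> a" and lower: "\<And>x. a \<le> w x" and upper: "\<And>x. w x \<le> b * (e x)\<^sup>2"
  shows "integrable \<mu> (\<lambda>x. f x * w x)"
    and "a / 2 * (\<integral>x. f x \<partial>\<mu>) \<le> (\<integral>x\<in>B. f x * w x \<partial>\<mu>)"
    and "(\<integral>x\<in>-B. \<bar>f x * w x\<bar> \<partial>\<mu>) \<le> b * (\<tau> * (\<integral>x. f x \<partial>\<mu>))"
    and "0 \<le> (\<integral>x. f x \<partial>\<mu>)"
proof -
  note [measurable] = FconeD(1)[OF f]
  note int = FconeD(3)[OF f]
  note int2 = Fcone_int[OF f]
  have b: "0 \<le> b"
  proof -
    have "0 \<le> b * (e x0)\<^sup>2"
      using lower[of x0] upper[of x0] \<open>0 \<le> a\<close> by linarith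
    then show ?thesis
      using e_pos(1)[of x0] by (simp add: zero_le_mult_iff)
  qed
  have bd: "\<bar>f x * w x\<bar> \<le> b * (\<bar>f x\<bar> * (e x)\<^sup>2)" for x
    using mult_left_mono[OF upper[of x], of "\<bar>f x\<bar>"] lower[of x] \<open>0 \<le> a\<close>
    by (simp add: abs_mult mult_ac)
  show fw: "integrable \<mu> (\<lambda>x. f x * w x)"
  proof (rule Bochner_Integration.integrable_bound)
    show "integrable \<mu> (\<lambda>x. b * (\<bar>f x\<bar> * (e x)\<^sup>2))"
      using int2 by simp
    have "norm (f x * w x) \<le> norm (b * (\<bar>f x\<bar> * (e x)\<^sup>2))" for x
      using bd[of x] b by (simp add: abs_mult)
    then show "AE x in \<mu>. norm (f x * w x) \<le> norm (b * (\<bar>f x\<bar> * (e x)\<^sup>2))"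
      by simp
  qed measurable
  have "(\<integral>x\<in>-B. \<bar>f x * w x\<bar> \<partial>\<mu>) \<le> (\<integral>x\<in>-B. b * (\<bar>f x\<bar> * (e x)\<^sup>2) \<partial>\<mu>)"
    using bd int2 by (intro set_integral_mono set_integrable_Compl integrable_abs fw) simp_all
  also have "\<dots> = b * (\<integral>x\<in>-B. \<bar>f x\<bar> * (e x)\<^sup>2 \<partial>\<mu>)"
    by simp
  also have "\<dots> \<le> b * (\<tau> * (\<integral>x. f x \<partial>\<mu>))"
    by (intro mult_left_mono b Fcone_tail f)
  finally show "(\<integral>x\<in>-B. \<bar>f x * w x\<bar> \<partial>\<mu>) \<le> b * (\<tau> * (\<integral>x. f x \<partial>\<mu>))" .
  have "0 \<le> (\<integral>x\<in>-B. \<bar>f x\<bar> * (e x)\<^sup>2 \<partial>\<mu>)"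
    unfolding set_lebesgue_integral_def by (intro Bochner_Integration.integral_nonneg) auto
  then have "0 \<le> \<tau> * (\<integral>x. f x \<partial>\<mu>)"
    using Fcone_tail[OF f] by linarith
  then show I: "0 \<le> (\<integral>x. f x \<partial>\<mu>)"
    using tau_pos by (simp add: zero_le_mult_iff)
  have "(\<integral>x\<in>-B. f x \<partial>\<mu>) \<le> (\<integral>x\<in>-B. \<bar>f x\<bar> * (e x)\<^sup>2 \<partial>\<mu>)"
  proof (intro set_integral_mono set_integrable_Compl int int2)
    show "f x \<le> \<bar>f x\<bar> * (e x)\<^sup>2" for x
      using mult_left_mono[OF e_pos(4)[of x], of "\<bar>f x\<bar>"] by simp
  qed simp_all
  also have "\<dots> \<le> \<tau> * (\<integral>x. f x \<partial>\<mu>)"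
    by (rule Fcone_tail[OF f])
  also have "\<dots> \<le> 1 / 2 * (\<integral>x. f x \<partial>\<mu>)"
    using I tau_le(2) by (intro mult_right_mono) auto
  finally have "1 / 2 * (\<integral>x. f x \<partial>\<mu>) \<le> (\<integral>x\<in>B. f x \<partial>\<mu>)"
    using integral_split[OF int B_sets(1)[of m]] by linarith
  then have "a / 2 * (\<integral>x. f x \<partial>\<mu>) \<le> a * (\<integral>x\<in>B. f x \<partial>\<mu>)"
    using mult_left_mono[OF _ \<open>0 \<le> a\<close>] by fastforce
  also have "\<dots> = (\<integral>x\<in>B. a * f x \<partial>\<mu>)"
    by simp
  also have "\<dots> \<le> (\<integral>x\<in>B. f x * w x \<partial>\<mu>)"
  proof (intro set_integral_mono_AE set_integrable_Compl fw)
    show "AE x\<in>B in \<mu>. a * f x \<le> f x * w x"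
      using FconeD(4)[OF f] by eventually_elim (metis lower mult.commute mult_left_mono)
  qed (use int in simp_all)
  finally show "a / 2 * (\<integral>x. f x \<partial>\<mu>) \<le> (\<integral>x\<in>B. f x * w x \<partial>\<mu>)" .
qed

text \<open>\<open>\<Phi>\<close> is not linear, so invariance of the dual cone is read off from the
  pointwise bounds: the ball contributes at least \<open>?s / (8 * E)\<close> times the integral of
  \<open>f\<close>, the complement at most \<open>2 * ?s * \<tau>\<close> times it in absolute
  value, and \<open>16 * E * \<tau> \<le> 1\<close>.\<close>

lemma sinkhorn_Gpos:
  assumes g: "g \<in> Gpos"
  shows "\<Phi> g \<in> Gpos"
proof -
  let ?s = "\<integral>x. g x \<partial>\<mu>"
  have s: "0 < ?s"
    by (rule Gpos_integral(1)[OF g])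
  have "0 \<le> (\<integral>x. f x * \<Phi> g x \<partial>\<mu>)" if f: "f \<in> F" for f
  proof -
    let ?I = "\<integral>x. f x \<partial>\<mu>"
    have up: "\<Phi> g x \<le> 2 * ?s * (e x)\<^sup>2" for x
    proof -
      have "2 * ?s * e x \<le> 2 * ?s * (e x)\<^sup>2"
        using s e_pos(3) by (intro mult_left_mono) auto
      then show ?thesis
        using sinkhorn_bounds(2)[OF g, of x] by linarith
    qed
    have s0: "0 \<le> ?s / (4 * E)"
      using s E_ge_1 by simp
    note * = Fcone_weighted[OF f sinkhorn_bounds(3)[OF g] s0 sinkhorn_bounds(1)[OF g] up]
    have "- (\<integral>x\<in>-B. f x * \<Phi> g x \<partial>\<mu>) \<le> (\<integral>x\<in>-B. \<bar>f x * \<Phi> g x\<bar> \<partial>\<mu>)"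
      using set_integral_norm_bound[OF set_integrable_Compl(2)[OF *(1) B_sets(1)[of m]]]
      unfolding real_norm_def by linarith
    moreover have "2 * ?s * (\<tau> * ?I) \<le> ?s / (4 * E) / 2 * ?I"
    proof -
      have "\<tau> \<le> 1 / (16 * E)"
        using tau_le(1) E_ge_1 by (simp add: field_simps)
      then have "2 * ?s * (\<tau> * ?I) \<le> 2 * ?s * (1 / (16 * E) * ?I)"
        using s *(4) by (intro mult_left_mono mult_right_mono) auto
      then show ?thesis
        by (simp add: mult.commute)
    qed
    ultimately show ?thesis
      using *(2,3) integral_split[OF *(1) B_sets(1)[of m]] by linarith
  qed
  then have "\<Phi> g \<in> G"
    unfolding Gcone_def measurable_borel_iff mem_Collect_eq
    by (intro conjI ballI sinkhorn_bounds(3)[OF g] sinkhorn_square_integrable[OF g])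
  moreover have "\<not> (AE x in \<mu>. \<Phi> g x = 0)"
  proof
    assume "AE x in \<mu>. \<Phi> g x = 0"
    then have "AE x in \<mu>. False"
      by eventually_elim (metis sinkhorn_pos[OF g] less_irrefl)
    then show False
      using \<mu>.AE_False by simp
  qed
  moreover have "AE x in \<mu>. 0 \<le> \<Phi> g x"
    using sinkhorn_pos[OF g] by (intro AE_I2 less_imp_le)
  ultimately show ?thesis
    by (intro CollectI conjI)
qed

text \<open>Both applications of \<^term>\<open>S_op\<close> are absorbed into the positive weights
  \<^term>\<open>1 / (LT_op K \<mu> g y * LT_op K \<mu> g' y)\<close> and \<^term>\<open>\<Phi> g x * \<Phi> g' x\<close>, since
  \<open>b / u' - a / u = (b u - a u') / (u u')\<close>. What remains is linear and can be moved to
  the test function by Fubini.\<close>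

lemma sinkhorn_pairing:
  assumes g: "g \<in> Gpos" and g': "g' \<in> Gpos" and f: "f \<in> F"
  obtains A h where "0 \<le> A" "h \<in> borel_measurable borel"
    "\<And>x. x \<in> B \<Longrightarrow> A / (2 * E) \<le> h x" "\<And>x. \<bar>h x\<bar> \<le> 2 * A"
    "\<And>a b. (\<integral>x. f x * (b * \<Phi> g' x - a * \<Phi> g x) \<partial>\<mu>) = (\<integral>x. (b * g' x - a * g x) * h x \<partial>\<mu>)"
proof -
  define s s' I where "s = (\<integral>x. g x \<partial>\<mu>)" and "s' = (\<integral>x. g' x \<partial>\<mu>)" and "I = (\<integral>x. f x \<partial>\<mu>)"
  have s: "0 < s" "0 < s'"
    using Gpos_integral(1)[OF g] Gpos_integral(1)[OF g'] unfolding s_def s'_def by blast+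
  have gG: "g \<in> G" "g' \<in> G"
    using g g' by blast+
  note meas [measurable] = GconeD(1)[OF gG(1)] GconeD(1)[OF gG(2)] FconeD(1)[OF f]
    sinkhorn_bounds(3)[OF g] sinkhorn_bounds(3)[OF g']
  note \<Phi>b = sinkhorn_bounds(1,2)[OF g, folded s_def] sinkhorn_bounds(1,2)[OF g', folded s'_def]
  note \<Phi>pos = sinkhorn_pos[OF g] sinkhorn_pos[OF g']
  define k k' where "k = S_op (LT_op K \<mu> g)" and "k' = S_op (LT_op K \<mu> g')"
  have [measurable]: "k \<in> borel_measurable borel" "k' \<in> borel_measurable borel"
    unfolding k_def k'_def by measurable
  note kb = S_LT_bounds[OF g, folded s_def k_def] S_LT_bounds[OF g', folded s'_def k'_def]

  define \<phi> where "\<phi> = (\<lambda>x. f x * (\<Phi> g x * \<Phi> g' x))"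
  have [measurable]: "\<phi> \<in> borel_measurable borel"
    unfolding \<phi>_def by measurable
  have "(\<lambda>x. \<Phi> g x * \<Phi> g' x) \<in> borel_measurable borel"
    by measurable
  moreover have "0 \<le> s / (4 * E) * (s' / (4 * E))"
    using s E_ge_1 by simp
  moreover have "s / (4 * E) * (s' / (4 * E)) \<le> \<Phi> g x * \<Phi> g' x" for x
    using s E_ge_1 \<Phi>b \<Phi>pos[of x] by (intro mult_mono) (simp_all add: less_imp_le)
  moreover have "\<Phi> g x * \<Phi> g' x \<le> 4 * s * s' * (e x)\<^sup>2" for x
  proof -
    have "\<Phi> g x * \<Phi> g' x \<le> 2 * s * e x * (2 * s' * e x)"
      using s e_pos(1)[of x] \<Phi>b \<Phi>pos[of x] by (intro mult_mono) (simp_all add: less_imp_le)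
    then show ?thesis
      by (simp add: power2_eq_square mult_ac)
  qed
  ultimately have \<phi>: "integrable \<mu> \<phi>" "s / (4 * E) * (s' / (4 * E)) / 2 * I \<le> (\<integral>x\<in>B. \<phi> x \<partial>\<mu>)"
    "(\<integral>x\<in>-B. \<bar>\<phi> x\<bar> \<partial>\<mu>) \<le> 4 * s * s' * (\<tau> * I)" "0 \<le> I"
    unfolding \<phi>_def I_def by (rule Fcone_weighted[OF f])+
  define A1 where "A1 = (\<integral>x\<in>B. \<phi> x \<partial>\<mu>)"
  have "0 \<le> s / (4 * E) * (s' / (4 * E)) / 2 * I"
    using s E_ge_1 \<phi>(4) by simp
  then have A1: "0 \<le> A1"
    using \<phi>(2) unfolding A1_def by linarith
  have \<phi>_nonneg: "AE x in \<mu>. x \<in> B \<longrightarrow> 0 \<le> \<phi> x"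
    using FconeD(4)[OF f]
  proof eventually_elim
    case (elim x)
    then show ?case
      using \<Phi>pos[of x] unfolding \<phi>_def by (auto intro: mult_nonneg_nonneg less_imp_le)
  qed
  have "4 * s * s' * (\<tau> * I) \<le> A1 / (2 * E)"
  proof -
    \<comment> \<open>Origin of the cube: two factors \<open>E\<close> come from the lower bounds on
      the two iterates and one from the lower bound on the kernel. The number 256 is 4, from the
      upper bound on the product of iterates, times 64 = 4 * 4 * 2 * 2 from the lower side.\<close>
    have "\<tau> \<le> 1 / (256 * E ^ 3)"
      using tau_E E_ge_1 by (simp add: field_simps)
    then have "4 * s * s' * (\<tau> * I) \<le> 4 * s * s' * (1 / (256 * E ^ 3) * I)"
      using s \<phi>(4) by (intro mult_left_mono mult_right_mono) auto
    also have "\<dots> = (s / (4 * E) * (s' / (4 * E)) / 2 * I) / (2 * E)"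
      using E_ge_1 by (simp add: field_simps power3_eq_cube)
    also have "\<dots> \<le> A1 / (2 * E)"
      using \<phi>(2) E_ge_1 unfolding A1_def by (intro divide_right_mono) auto
    finally show ?thesis .
  qed
  with \<phi>(3) have \<phi>_tail: "(\<integral>x\<in>-B. \<bar>\<phi> x\<bar> \<partial>\<mu>) \<le> (\<integral>x\<in>B. \<phi> x \<partial>\<mu>) / (2 * E)"
    unfolding A1_def by linarith
  have Kmu: "(\<lambda>x. K x y) \<in> borel_measurable \<mu>" and Knu: "(\<lambda>x. K y x) \<in> borel_measurable \<nu>" for y
    by measurable
  define F1 where "F1 = LT_op K \<mu> \<phi>"
  have [measurable]: "F1 \<in> borel_measurable borel"
    unfolding F1_def by measurable
  note k1 = kernel_integral_bounds[OF \<phi>(1) B_sets(1)[of m] Kmu less_imp_le[OF K_pos] K_le_1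
      \<phi>_nonneg \<phi>_tail E_ge_1]
  have F1_abs: "\<bar>F1 y\<bar> \<le> 2 * A1" for y
    unfolding F1_def LT_op_def A1_def by (rule k1(1))
  have F1_lower: "A1 / (2 * E) \<le> F1 y" if "y \<in> B" for y
    unfolding F1_def LT_op_def A1_def
  proof (rule k1(2))
    show "1 / E \<le> K x y" if "x \<in> B" for x
      using K_lower1[OF that, of y] e_eq[OF \<open>y \<in> B\<close>] by simp
  qed

  define \<psi> where "\<psi> = (\<lambda>y. k y * k' y * F1 y)"
  have kpos: "0 < k y" "0 < k' y" for y
    using kb(1,4)[of y] s divide_pos_pos[of 1 s] divide_pos_pos[of 1 s'] by linarith+
  \<comment> \<open>Each reciprocal grows at most like \<open>e\<close>, and \<open>F1\<close> is
    bounded everywhere although its sign is known only on the ball; so \<open>\<psi>\<close> again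
    has the shape of a test function with a weight of second order.\<close>
  have \<psi>_abs: "\<bar>\<psi> y\<bar> \<le> 8 * A1 / (s * s') * (e y)\<^sup>2" for y
  proof -
    have "\<bar>\<psi> y\<bar> = k y * k' y * \<bar>F1 y\<bar>"
      using kpos[of y] by (simp add: \<psi>_def abs_mult)
    also have "\<dots> \<le> 2 * e y / s * (2 * e y / s') * (2 * A1)"
      using s e_pos(1)[of y] kb(2,5)[of y] kpos[of y] F1_abs[of y]
      by (intro mult_mono mult_nonneg_nonneg) (simp_all add: less_imp_le)
    also have "\<dots> = 8 * A1 / (s * s') * (e y)\<^sup>2"
      by (simp add: power2_eq_square)
    finally show ?thesis .
  qed
  have c0: "0 \<le> 8 * A1 / (s * s')"
    using A1 s by simp
  have \<psi>: "integrable \<nu> \<psi>"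
  proof (rule Bochner_Integration.integrable_bound)
    show "integrable \<nu> (\<lambda>y. 8 * A1 / (s * s') * (e y)\<^sup>2)"
      using int_e2_nu by simp
    have "norm (\<psi> y) \<le> norm (8 * A1 / (s * s') * (e y)\<^sup>2)" for y
      using \<psi>_abs[of y] unfolding real_norm_def by linarith
    then show "AE y in \<nu>. norm (\<psi> y) \<le> norm (8 * A1 / (s * s') * (e y)\<^sup>2)"
      by (intro AE_I2)
    show "\<psi> \<in> borel_measurable \<nu>"
      unfolding \<psi>_def by measurable
  qed
  define A2 where "A2 = (\<integral>x\<in>B. \<psi> x \<partial>\<nu>)"
  have \<psi>_lower: "1 / s * (1 / s') * (A1 / (2 * E)) \<le> \<psi> y" if "y \<in> B" for y
    unfolding \<psi>_def
  proof (intro mult_mono)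
    show "0 \<le> A1 / (2 * E)"
      using A1 E_ge_1 by simp
  qed (use s kpos[of y] kb(1,4)[of y] F1_lower[OF that] in \<open>simp_all add: less_imp_le\<close>)
  have low0: "0 \<le> 1 / s * (1 / s') * (A1 / (2 * E))"
    using s A1 E_ge_1 by simp
  have \<psi>_nonneg: "AE y in \<nu>. y \<in> B \<longrightarrow> 0 \<le> \<psi> y"
    by (intro AE_I2 impI order_trans[OF low0 \<psi>_lower])
  have "1 / s * (1 / s') * (A1 / (2 * E)) * (1 / 2) \<le> 1 / s * (1 / s') * (A1 / (2 * E)) * measure \<nu> B"
    using nu_B low0 by (rule mult_left_mono)
  also have "\<dots> = (\<integral>y\<in>B. 1 / s * (1 / s') * (A1 / (2 * E)) \<partial>\<nu>)"
    by (simp add: set_lebesgue_integral_def)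
  also have "\<dots> \<le> A2"
    unfolding A2_def using \<psi>_lower by (intro set_integral_mono set_integrable_Compl \<psi>) simp_all
  finally have A2_lower: "1 / s * (1 / s') * (A1 / (2 * E)) * (1 / 2) \<le> A2" .
  moreover have "0 \<le> 1 / s * (1 / s') * (A1 / (2 * E)) * (1 / 2)"
    using low0 by (rule mult_nonneg_nonneg) simp
  ultimately have A2: "0 \<le> A2"
    by linarith
  have "(\<integral>y\<in>-B. \<bar>\<psi> y\<bar> \<partial>\<nu>) \<le> (\<integral>y\<in>-B. 8 * A1 / (s * s') * (e y)\<^sup>2 \<partial>\<nu>)"
    using \<psi>_abs int_e2_nu by (intro set_integral_mono set_integrable_Compl integrable_abs \<psi>) simp_all
  also have "\<dots> = 8 * A1 / (s * s') * (\<integral>y\<in>-B. (e y)\<^sup>2 \<partial>\<nu>)"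
    by simp
  \<comment> \<open>Here the square of \<open>E\<close> suffices: unlike the iterates,
    \<open>k\<close> and \<open>k'\<close> are bounded below by constants without \<open>E\<close>,
    so one factor comes from \<open>F1\<close> and one from the kernel.\<close>
  also have "\<dots> \<le> 8 * A1 / (s * s') * (1 / (256 * E\<^sup>2))"
  proof (rule mult_left_mono[OF _ c0])
    have "\<tau> \<le> 1 / (256 * E\<^sup>2)"
      using tau_le(3) E_ge_1 by (simp add: field_simps)
    then show "(\<integral>y\<in>-B. (e y)\<^sup>2 \<partial>\<nu>) \<le> 1 / (256 * E\<^sup>2)"
      using tail_e2_nu by linarith
  qed
  also have "\<dots> \<le> 8 * A1 / (s * s') * (1 / (64 * E\<^sup>2))"
    using E_ge_1 by (intro mult_left_mono[OF _ c0]) (simp add: divide_left_mono)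
  also have "\<dots> = (1 / s * (1 / s') * (A1 / (2 * E)) * (1 / 2)) / (2 * E)"
    using E_ge_1 s by (simp add: field_simps power2_eq_square)
  also have "\<dots> \<le> A2 / (2 * E)"
    using A2_lower E_ge_1 by (intro divide_right_mono) simp_all
  finally have \<psi>_tail: "(\<integral>y\<in>-B. \<bar>\<psi> y\<bar> \<partial>\<nu>) \<le> (\<integral>y\<in>B. \<psi> y \<partial>\<nu>) / (2 * E)"
    unfolding A2_def .
  define h where "h = L_op K \<nu> \<psi>"
  note k2 = kernel_integral_bounds[OF \<psi> B_sets(2)[of m] Knu less_imp_le[OF K_pos] K_le_1
      \<psi>_nonneg \<psi>_tail E_ge_1]

  show thesis
  proof (rule that[OF A2])
    show "h \<in> borel_measurable borel"
      unfolding h_def \<psi>_def by measurable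
    show "\<bar>h x\<bar> \<le> 2 * A2" for x
      unfolding h_def L_op_def A2_def by (rule k2(1))
    show "A2 / (2 * E) \<le> h x" if "x \<in> B" for x
      unfolding h_def L_op_def A2_def
    proof (rule k2(2))
      show "1 / E \<le> K x y" if "y \<in> B" for y
        using K_lower2[OF that, of x] e_eq[OF \<open>x \<in> B\<close>] by simp
    qed
    fix a b :: real
    let ?u = "\<lambda>x. b * g' x - a * g x"
    have gi: "integrable \<mu> g" "integrable \<mu> g'"
      using gG by (auto intro: Gcone_integrable)
    have u: "integrable \<mu> ?u"
      using gi by simp
    have LTu: "LT_op K \<mu> ?u y = b * LT_op K \<mu> g' y - a * LT_op K \<mu> g y" for y
    proof -
      have "LT_op K \<mu> ?u y = (\<integral>x. b * (K x y * g' x) - a * (K x y * g x) \<partial>\<mu>)"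
        unfolding LT_op_def by (intro Bochner_Integration.integral_cong) (simp_all add: algebra_simps)
      also have "\<dots> = b * LT_op K \<mu> g' y - a * LT_op K \<mu> g y"
        unfolding LT_op_def using kernel_integrable(1)[OF gi(1)] kernel_integrable(1)[OF gi(2)] by simp
      finally show ?thesis .
    qed
    \<comment> \<open>The inner reciprocal exchanges the roles of \<open>g\<close> and
      \<open>g'\<close>: \<open>b\<close> now multiplies the reciprocal that belongs to
      \<open>g\<close>. The outer reciprocal exchanges them back, which is why \<open>\<Phi>\<close>
      preserves the order instead of reversing it.\<close>
    have kk: "k y * k' y * LT_op K \<mu> ?u y = b * k y - a * k' y" for y
    proof -
      have "LT_op K \<mu> g y \<noteq> 0" "LT_op K \<mu> g' y \<noteq> 0"
        using kpos[of y] unfolding k_def k'_def S_op_def by auto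
      then show ?thesis
        unfolding LTu by (simp add: k_def k'_def S_op_def field_simps)
    qed
    have Lk: "L_op K \<nu> (\<lambda>y. b * k y - a * k' y) x = b / \<Phi> g x - a / \<Phi> g' x" for x
    proof -
      have "L_op K \<nu> (\<lambda>y. b * k y - a * k' y) x = (\<integral>y. b * (K x y * k y) - a * (K x y * k' y) \<partial>\<nu>)"
        unfolding L_op_def by (intro Bochner_Integration.integral_cong) (simp_all add: algebra_simps)
      also have "\<dots> = b * L_op K \<nu> k x - a * L_op K \<nu> k' x"
        unfolding L_op_def using kernel_integrable(2)[OF kb(3)] kernel_integrable(2)[OF kb(6)] by simp
      finally show ?thesis
        by (simp add: sinkhorn_map_eq k_def k'_def)
    qed
    have Kprod: "(\<lambda>(x, y). K x y) \<in> borel_measurable (\<mu> \<Otimes>\<^sub>M \<nu>)"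
      using K_meas measurable_cong_sets[OF sets_pair_measure_cong[OF sets_mu sets_nu] refl] by blast
    have Kabs: "\<bar>K x y\<bar> \<le> 1" for x y
      using K_pos[of x y] K_le_1[of x y] by linarith
    have bk: "integrable \<nu> (\<lambda>y. b * k y - a * k' y)"
      using kb(3,6) by simp
    have "(\<integral>x. f x * (b * \<Phi> g' x - a * \<Phi> g x) \<partial>\<mu>) = (\<integral>x. \<phi> x * L_op K \<nu> (\<lambda>y. b * k y - a * k' y) x \<partial>\<mu>)"
    proof (rule Bochner_Integration.integral_cong)
      show "f x * (b * \<Phi> g' x - a * \<Phi> g x) = \<phi> x * L_op K \<nu> (\<lambda>y. b * k y - a * k' y) x" for x
        unfolding Lk \<phi>_def using \<Phi>pos[of x] by (simp add: field_simps)
    qed simp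
    also have "\<dots> = (\<integral>y. (b * k y - a * k' y) * F1 y \<partial>\<nu>)"
      unfolding F1_def by (rule kernel_adjoint[OF prob_mu prob_nu Kprod Kabs \<phi>(1) bk])
    also have "\<dots> = (\<integral>y. \<psi> y * LT_op K \<mu> ?u y \<partial>\<nu>)"
      unfolding kk[symmetric] \<psi>_def by (intro Bochner_Integration.integral_cong) (simp_all only: mult_ac)
    also have "\<dots> = (\<integral>x. ?u x * h x \<partial>\<mu>)"
      unfolding h_def by (rule kernel_adjoint[OF prob_mu prob_nu Kprod Kabs u \<psi>, symmetric])
    finally show "(\<integral>x. f x * (b * \<Phi> g' x - a * \<Phi> g x) \<partial>\<mu>) = (\<integral>x. ?u x * h x \<partial>\<mu>)" .
  qed
qed

section \<open>The order of the dual cone in terms of pairings\<close>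

lemma Gcone_combI:
  assumes p: "p \<in> G" and q: "q \<in> G"
    and nonneg: "\<And>f. f \<in> F \<Longrightarrow> 0 \<le> (\<integral>x. f x * (b * p x - a * q x) \<partial>\<mu>)"
  shows "(\<lambda>x. b * p x - a * q x) \<in> G"
  unfolding Gcone_def mem_Collect_eq
proof (intro conjI ballI nonneg)
  note [measurable] = GconeD(1)[OF p] GconeD(1)[OF q]
  show "(\<lambda>x. b * p x - a * q x) \<in> borel_measurable \<mu>"
    by measurable
  have "p \<in> borel_measurable \<mu>" "q \<in> borel_measurable \<mu>"
    by measurable
  then have "integrable \<mu> (\<lambda>x. p x * q x)"
    by (intro integrable_mult_square GconeD(2)[OF p] GconeD(2)[OF q])
  then have "integrable \<mu> (\<lambda>x. b\<^sup>2 * (p x)\<^sup>2 + a\<^sup>2 * (q x)\<^sup>2 - 2 * a * b * (p x * q x))"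
    using GconeD(2)[OF p] GconeD(2)[OF q] by simp
  moreover have "b\<^sup>2 * (p x)\<^sup>2 + a\<^sup>2 * (q x)\<^sup>2 - 2 * a * b * (p x * q x) = (b * p x - a * q x)\<^sup>2" for x
    by (simp add: power2_eq_square algebra_simps)
  ultimately show "integrable \<mu> (\<lambda>x. (b * p x - a * q x)\<^sup>2)"
    by simp
qed

lemma integrable_Fcone_Gcone:
  assumes f: "f \<in> F" and g: "g \<in> G"
  shows "integrable \<mu> (\<lambda>x. f x * g x)"
proof (rule integrable_mult_square)
  note [measurable] = FconeD(1)[OF f] GconeD(1)[OF g]
  show "f \<in> borel_measurable \<mu>" "g \<in> borel_measurable \<mu>"
    by measurable
qed (rule FconeD(2)[OF f] GconeD(2)[OF g])+

lemma Gcone_comb_iff: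
  assumes p: "p \<in> G" and q: "q \<in> G"
  shows "(\<lambda>x. b * p x - a * q x) \<in> G \<longleftrightarrow>
    (\<forall>f\<in>F. a * (\<integral>x. f x * q x \<partial>\<mu>) \<le> b * (\<integral>x. f x * p x \<partial>\<mu>))"
proof -
  have eq: "(\<integral>x. f x * (b * p x - a * q x) \<partial>\<mu>) =
      b * (\<integral>x. f x * p x \<partial>\<mu>) - a * (\<integral>x. f x * q x \<partial>\<mu>)" if "f \<in> F" for f
  proof -
    have "(\<integral>x. f x * (b * p x - a * q x) \<partial>\<mu>) = (\<integral>x. b * (f x * p x) - a * (f x * q x) \<partial>\<mu>)"
      by (intro Bochner_Integration.integral_cong) (simp_all add: algebra_simps)
    also have "\<dots> = b * (\<integral>x. f x * p x \<partial>\<mu>) - a * (\<integral>x. f x * q x \<partial>\<mu>)"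
      using integrable_Fcone_Gcone[OF that p] integrable_Fcone_Gcone[OF that q] by simp
    finally show ?thesis .
  qed
  show ?thesis
  proof
    assume *: "(\<lambda>x. b * p x - a * q x) \<in> G"
    show "\<forall>f\<in>F. a * (\<integral>x. f x * q x \<partial>\<mu>) \<le> b * (\<integral>x. f x * p x \<partial>\<mu>)"
    proof
      fix f assume f: "f \<in> F"
      show "a * (\<integral>x. f x * q x \<partial>\<mu>) \<le> b * (\<integral>x. f x * p x \<partial>\<mu>)"
        using GconeD(3)[OF * f] unfolding eq[OF f] by linarith
    qed
  next
    assume *: "\<forall>f\<in>F. a * (\<integral>x. f x * q x \<partial>\<mu>) \<le> b * (\<integral>x. f x * p x \<partial>\<mu>)"
    show "(\<lambda>x. b * p x - a * q x) \<in> G"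
    proof (rule Gcone_combI[OF p q])
      fix f assume f: "f \<in> F"
      show "0 \<le> (\<integral>x. f x * (b * p x - a * q x) \<partial>\<mu>)"
        unfolding eq[OF f] using bspec[OF * f] by linarith
    qed
  qed
qed

lemma Gcone_diff_iff:
  assumes "p \<in> G" "q \<in> G"
  shows "(\<lambda>x. b * p x - q x) \<in> G \<longleftrightarrow> (\<forall>f\<in>F. (\<integral>x. f x * q x \<partial>\<mu>) \<le> b * (\<integral>x. f x * p x \<partial>\<mu>))"
    and "(\<lambda>x. q x - b * p x) \<in> G \<longleftrightarrow> (\<forall>f\<in>F. b * (\<integral>x. f x * p x \<partial>\<mu>) \<le> (\<integral>x. f x * q x \<partial>\<mu>))"
  using Gcone_comb_iff[OF assms, of b 1] Gcone_comb_iff[OF assms(2,1), of 1 b] unfolding mult_1 by blast+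

text \<open>Pairing the image with any test function amounts to pairing the preimage with some
  \<open>h\<close>, which is worth at least \<open>A / (4 * E)\<close> per unit of integral on
  \<open>p\<close> and at most \<open>3 * A\<close> on \<open>q\<close>. A surplus of
  \<open>12 * E\<close> in the integrals thus settles the sign for all test functions at once. The
  coefficients \<open>a\<close>, \<open>b\<close> may be negative, so differences in both directions
  are covered, and the freedom to choose \<open>p\<close> and \<open>q\<close> is what later yields
  strict improvement.\<close>

lemma sinkhorn_comb_in_Gcone:
  assumes g: "g \<in> Gpos" and g': "g' \<in> Gpos" and p: "p \<in> G" and q: "q \<in> G"
    and eq: "\<And>x. b * g' x - a * g x = d * p x - c * q x" and "0 \<le> c" "0 \<le> d"
    and ge: "12 * E * (c * (\<integral>x. q x \<partial>\<mu>)) \<le> d * (\<integral>x. p x \<partial>\<mu>)"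
  shows "(\<lambda>x. b * \<Phi> g' x - a * \<Phi> g x) \<in> G"
proof (rule Gcone_combI)
  show "\<Phi> g \<in> G" "\<Phi> g' \<in> G"
    using sinkhorn_Gpos[OF g] sinkhorn_Gpos[OF g'] by blast+
  fix f assume f: "f \<in> F"
  obtain A h where A: "0 \<le> A" and h [measurable]: "h \<in> borel_measurable borel"
    and h_lower: "\<And>x. x \<in> B \<Longrightarrow> A / (2 * E) \<le> h x" and h_bound: "\<And>x. \<bar>h x\<bar> \<le> 2 * A"
    and h_eq: "\<And>a b. (\<integral>x. f x * (b * \<Phi> g' x - a * \<Phi> g x) \<partial>\<mu>) = (\<integral>x. (b * g' x - a * g x) * h x \<partial>\<mu>)"
    using sinkhorn_pairing[OF g g' f] by blast
  have int: "integrable \<mu> (\<lambda>x. u x * h x)" if "u \<in> G" for u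
  proof (rule integrable_mult_square)
    note [measurable] = GconeD(1)[OF that]
    show "u \<in> borel_measurable \<mu>" "h \<in> borel_measurable \<mu>"
      by measurable
    show "integrable \<mu> (\<lambda>x. (h x)\<^sup>2)"
    proof (rule \<mu>.integrable_const_bound)
      have "(h x)\<^sup>2 \<le> (2 * A)\<^sup>2" for x
        using power_mono[OF h_bound[of x], of 2] by simp
      then show "AE x in \<mu>. norm ((h x)\<^sup>2) \<le> (2 * A)\<^sup>2"
        by simp
    qed measurable
  qed (rule GconeD(2)[OF that])
  have pair: "A / (4 * E) * (\<integral>x. u x \<partial>\<mu>) \<le> (\<integral>x. u x * h x \<partial>\<mu>)"
    "(\<integral>x. u x * h x \<partial>\<mu>) \<le> 3 * A * (\<integral>x. u x \<partial>\<mu>)" if "u \<in> G" for u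
    by (rule bounded_pairing[OF h A]; fact h_lower h_bound that)+
  have "c * (\<integral>x. q x * h x \<partial>\<mu>) \<le> c * (3 * A * (\<integral>x. q x \<partial>\<mu>))"
    by (rule mult_left_mono[OF pair(2)[OF q] \<open>0 \<le> c\<close>])
  also have "\<dots> = A / (4 * E) * (12 * E * (c * (\<integral>x. q x \<partial>\<mu>)))"
    using E_ge_1 by simp
  also have "\<dots> \<le> A / (4 * E) * (d * (\<integral>x. p x \<partial>\<mu>))"
    using A E_ge_1 by (intro mult_left_mono[OF ge]) simp
  also have "\<dots> = d * (A / (4 * E) * (\<integral>x. p x \<partial>\<mu>))"
    by simp
  also have "\<dots> \<le> d * (\<integral>x. p x * h x \<partial>\<mu>)"
    by (rule mult_left_mono[OF pair(1)[OF p] \<open>0 \<le> d\<close>])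
  finally have "c * (\<integral>x. q x * h x \<partial>\<mu>) \<le> d * (\<integral>x. p x * h x \<partial>\<mu>)" .
  moreover have "d * (\<integral>x. p x * h x \<partial>\<mu>) - c * (\<integral>x. q x * h x \<partial>\<mu>) = (\<integral>x. (d * p x - c * q x) * h x \<partial>\<mu>)"
  proof -
    have "(\<integral>x. (d * p x - c * q x) * h x \<partial>\<mu>) = (\<integral>x. d * (p x * h x) - c * (q x * h x) \<partial>\<mu>)"
      by (intro Bochner_Integration.integral_cong) (simp_all add: algebra_simps)
    also have "\<dots> = d * (\<integral>x. p x * h x \<partial>\<mu>) - c * (\<integral>x. q x * h x \<partial>\<mu>)"
      using int[OF p] int[OF q] by simp
    finally show ?thesis
      by simp
  qed
  ultimately show "0 \<le> (\<integral>x. f x * (b * \<Phi> g' x - a * \<Phi> g x) \<partial>\<mu>)"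
    unfolding h_eq eq by linarith
qed

lemma Gcone_diff_integral:
  assumes p: "p \<in> G" and q: "q \<in> G"
  shows "(\<lambda>x. b * p x - q x) \<in> G \<Longrightarrow> (\<integral>x. q x \<partial>\<mu>) \<le> b * (\<integral>x. p x \<partial>\<mu>)"
    and "(\<lambda>x. q x - b * p x) \<in> G \<Longrightarrow> b * (\<integral>x. p x \<partial>\<mu>) \<le> (\<integral>x. q x \<partial>\<mu>)"
proof -
  assume "(\<lambda>x. b * p x - q x) \<in> G"
  then show "(\<integral>x. q x \<partial>\<mu>) \<le> b * (\<integral>x. p x \<partial>\<mu>)"
    unfolding Gcone_diff_iff[OF p q] by (drule_tac bspec[OF _ one_in_Fcone]) simp
next
  assume "(\<lambda>x. q x - b * p x) \<in> G"
  then show "b * (\<integral>x. p x \<partial>\<mu>) \<le> (\<integral>x. q x \<partial>\<mu>)"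
    unfolding Gcone_diff_iff[OF p q] by (drule_tac bspec[OF _ one_in_Fcone]) simp
qed

lemma Gcone_diff_swap:
  assumes p: "p \<in> G" and q: "q \<in> G" and "0 < a"
  shows "(\<lambda>x. 1 / a * p x - q x) \<in> G \<longleftrightarrow> (\<lambda>x. p x - a * q x) \<in> G"
  unfolding Gcone_diff_iff(1)[OF p q] Gcone_diff_iff(2)[OF q p]
  using \<open>0 < a\<close> by (intro ball_cong refl) (simp add: pos_le_divide_eq mult.commute)

lemma Gpos_G: "g \<in> Gpos \<Longrightarrow> g \<in> G"
  by (elim CollectE conjE)

section \<open>Hilbert's metric and the contraction estimate\<close>

text \<open>The dual cone is an intersection of half-spaces, so each test function restricts the
  admissible multiples by a closed condition and the extremal multiples are admissible themselves.
  Equivalence makes both sets nonempty and testing with 1 bounds them by the quotient of the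
  integrals, so \<open>Inf\<close> and \<open>Sup\<close> are genuine.\<close>

lemma hilbert_attained:
  assumes g: "g \<in> Gpos" and g': "g' \<in> Gpos" and "cone_equiv G g g'"
  shows "(\<lambda>x. hilbert_M G g g' * g' x - g x) \<in> G" and "(\<lambda>x. g x - hilbert_m G g g' * g' x) \<in> G"
    and "0 < hilbert_m G g g'" and "hilbert_m G g g' \<le> hilbert_M G g g'"
    and "\<And>b. 0 < b \<Longrightarrow> (\<lambda>x. b * g' x - g x) \<in> G \<Longrightarrow> hilbert_M G g g' \<le> b"
    and "\<And>a. 0 < a \<Longrightarrow> (\<lambda>x. g x - a * g' x) \<in> G \<Longrightarrow> a \<le> hilbert_m G g g'"
proof -
  note G = Gpos_G[OF g] Gpos_G[OF g']
  let ?s = "\<integral>x. g x \<partial>\<mu>" and ?s' = "\<integral>x. g' x \<partial>\<mu>"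
  have s: "0 < ?s" "0 < ?s'"
    by (rule Gpos_integral(1)[OF g] Gpos_integral(1)[OF g'])+
  define SM Sm where "SM = {b. b > 0 \<and> (\<lambda>x. b * g' x - g x) \<in> G}"
    and "Sm = {a. a > 0 \<and> (\<lambda>x. g x - a * g' x) \<in> G}"
  have M_def: "hilbert_M G g g' = Inf SM" and m_def: "hilbert_m G g g' = Sup Sm"
    unfolding hilbert_M_def hilbert_m_def SM_def Sm_def by (rule refl)+
  obtain b0 where "b0 > 0" "(\<lambda>x. b0 * g' x - g x) \<in> G"
    using assms(3) unfolding cone_equiv_def cone_le_def by blast
  then have SM_ne: "SM \<noteq> {}"
    unfolding SM_def by blast
  obtain b1 where b1: "b1 > 0" "(\<lambda>x. b1 * g x - g' x) \<in> G"
    using assms(3) unfolding cone_equiv_def cone_le_def by blast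
  have "(\<lambda>x. g x - 1 / b1 * g' x) \<in> G"
    using b1 by (subst Gcone_diff_swap[OF G, symmetric]) simp_all
  with b1(1) have a1: "1 / b1 \<in> Sm"
    unfolding Sm_def by simp
  have SM_ge: "?s / ?s' \<le> b" if "b \<in> SM" for b
    using that Gcone_diff_integral(1)[OF G(2,1), of b] s unfolding SM_def by (simp add: divide_le_eq)
  have Sm_le: "a \<le> ?s / ?s'" if "a \<in> Sm" for a
    using that Gcone_diff_integral(2)[OF G(2,1), of a] s unfolding Sm_def by (simp add: le_divide_eq)
  have bdd: "bdd_below SM" "bdd_above Sm"
    by (rule bdd_belowI[OF SM_ge] bdd_aboveI[OF Sm_le], assumption)+
  show "hilbert_m G g g' \<le> hilbert_M G g g'"
    unfolding M_def m_def
  proof (rule order_trans)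
    show "Sup Sm \<le> ?s / ?s'"
      using a1 by (intro cSup_least Sm_le) blast+
    show "?s / ?s' \<le> Inf SM"
      by (intro cInf_greatest SM_ne SM_ge)
  qed
  have "1 / b1 \<le> hilbert_m G g g'"
    unfolding m_def by (rule cSup_upper[OF a1 bdd(2)])
  moreover have "0 < 1 / b1"
    using b1 by simp
  ultimately show "0 < hilbert_m G g g'"
    by linarith
  show "hilbert_M G g g' \<le> b" if "0 < b" "(\<lambda>x. b * g' x - g x) \<in> G" for b
    unfolding M_def using that bdd(1) by (intro cInf_lower) (simp_all add: SM_def)
  show "a \<le> hilbert_m G g g'" if "0 < a" "(\<lambda>x. g x - a * g' x) \<in> G" for a
    unfolding m_def using that bdd(2) by (intro cSup_upper) (simp_all add: Sm_def)
  show "(\<lambda>x. hilbert_M G g g' * g' x - g x) \<in> G"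
    unfolding Gcone_diff_iff[OF G(2,1)]
  proof
    fix f assume f: "f \<in> F"
    let ?X = "\<integral>x. f x * g' x \<partial>\<mu>" and ?Y = "\<integral>x. f x * g x \<partial>\<mu>"
    have Y: "?Y \<le> b * ?X" if "b \<in> SM" for b
      using that f unfolding SM_def mem_Collect_eq Gcone_diff_iff[OF G(2,1)] by blast
    show "?Y \<le> hilbert_M G g g' * ?X"
    proof (cases "?X = 0")
      case True
      then show ?thesis
        using Y SM_ne by auto
    next
      case False
      then have X: "0 < ?X"
        using GconeD(3)[OF G(2) f] by linarith
      have "?Y / ?X \<le> hilbert_M G g g'"
        unfolding M_def using SM_ne Y X by (intro cInf_greatest) (simp_all add: divide_le_eq)
      then show ?thesis
        using X by (simp add: divide_le_eq)
    qed
  qed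
  show "(\<lambda>x. g x - hilbert_m G g g' * g' x) \<in> G"
    unfolding Gcone_diff_iff[OF G(2,1)]
  proof
    fix f assume f: "f \<in> F"
    let ?X = "\<integral>x. f x * g' x \<partial>\<mu>" and ?Y = "\<integral>x. f x * g x \<partial>\<mu>"
    have Y: "a * ?X \<le> ?Y" if "a \<in> Sm" for a
      using that f unfolding Sm_def mem_Collect_eq Gcone_diff_iff[OF G(2,1)] by blast
    show "hilbert_m G g g' * ?X \<le> ?Y"
    proof (cases "?X = 0")
      case True
      then show ?thesis
        using Y[OF a1] by simp
    next
      case False
      then have X: "0 < ?X"
        using GconeD(3)[OF G(2) f] by linarith
      have "hilbert_m G g g' \<le> ?Y / ?X"
        unfolding m_def using a1 Y X by (intro cSup_least) (auto simp: le_divide_eq)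
      then show ?thesis
        using X by (simp add: le_divide_eq)
    qed
  qed
qed

lemma hilbert_dist_le:
  assumes g: "g \<in> Gpos" and g': "g' \<in> Gpos" and "0 < a" "0 < b"
    and b: "(\<lambda>x. b * g' x - g x) \<in> G" and a: "(\<lambda>x. g x - a * g' x) \<in> G"
  shows "hilbert_dist G \<mu> g g' \<le> ereal (ln (b / a))"
proof -
  note G = Gpos_G[OF g] Gpos_G[OF g']
  have "(\<lambda>x. 1 / a * g x - g' x) \<in> G"
    using a \<open>0 < a\<close> by (subst Gcone_diff_swap[OF G])
  then have equiv: "cone_equiv G g g'"
    unfolding cone_equiv_def cone_le_def using b \<open>0 < b\<close> \<open>0 < a\<close>
    by (intro conjI exI[of _ b] exI[of _ "1 / a"]) simp_all
  note h = hilbert_attained[OF g g' equiv]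
  have "hilbert_M G g g' / hilbert_m G g g' \<le> b / a"
    using h(3,4) h(5)[OF \<open>0 < b\<close> b] h(6)[OF \<open>0 < a\<close> a] \<open>0 < a\<close> by (intro frac_le) simp_all
  moreover have "0 < hilbert_M G g g' / hilbert_m G g g'"
    using h(3,4) by simp
  ultimately have "ln (hilbert_M G g g' / hilbert_m G g g') \<le> ln (b / a)"
    by simp
  moreover have "\<not> (AE x in \<mu>. g' x = 0)"
    using g' by (elim CollectE conjE)
  ultimately show ?thesis
    unfolding hilbert_dist_def using equiv by simp
qed

text \<open>Moving both ends of the bracket inwards helps for moderate \<open>t = M / m'\<close>;
  for large \<open>t\<close> the image distance is at most \<open>ln ((12 * E)\<^sup>2)\<close>
  anyway. The threshold \<open>(12 * E) ^ 4\<close> is the square of that number, so beyond it the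
  factor \<open>1 / 2\<close> is available.\<close>

theorem sinkhorn_contraction:
  assumes g: "g \<in> Gpos" and g': "g' \<in> Gpos"
    and \<kappa>: "1 / 2 \<le> \<kappa>" "1 - 1 / (12 * E) / (12 * E) ^ 4 \<le> \<kappa>"
  shows "hilbert_dist G \<mu> (\<Phi> g) (\<Phi> g') \<le> ereal \<kappa> * hilbert_dist G \<mu> g g'"
    (is "?L \<le> _")
proof (cases "cone_equiv G g g'")
  case False
  then have "hilbert_dist G \<mu> g g' = \<infinity>"
    unfolding hilbert_dist_def by simp
  \<comment> \<open>Positivity of \<open>\<kappa>\<close> matters here, because zero times infinity
    is zero in \<open>ereal\<close>.\<close>
  with \<kappa>(1) show ?thesis
    by simp
next
  case True
  note G = Gpos_G[OF g] Gpos_G[OF g']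
  note \<Phi> = sinkhorn_Gpos[OF g] sinkhorn_Gpos[OF g']
  let ?s = "\<integral>x. g x \<partial>\<mu>" and ?s' = "\<integral>x. g' x \<partial>\<mu>"
  have s: "0 < ?s" "0 < ?s'"
    by (rule Gpos_integral(1)[OF g] Gpos_integral(1)[OF g'])+
  define M m' t \<theta> where "M = hilbert_M G g g'" and "m' = hilbert_m G g g'" and "t = M / m'"
    and "\<theta> = 1 / (12 * E)"
  note h = hilbert_attained[OF g g' True, folded M_def m'_def]
  have t: "1 \<le> t"
    using h(3,4) by (simp add: t_def)
  have \<theta>: "0 < \<theta>" "\<theta> < 1" "1 / \<theta> = 12 * E"
    using E_ge_1 by (simp_all add: \<theta>_def)
  have "\<not> (AE x in \<mu>. g' x = 0)"
    using g' by (elim CollectE conjE)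
  then have dist: "hilbert_dist G \<mu> g g' = ereal (ln t)"
    using True by (simp add: hilbert_dist_def t_def M_def m'_def)

  \<comment> \<open>The integrals of the two gaps, in units of the integral of \<open>g'\<close>.
    With \<open>\<theta> = 1 / (12 * E)\<close>, the multiple \<open>\<theta> * u\<close> of
    \<open>g'\<close> is exactly what may be taken from the gap \<open>M * g' - g\<close> while its
    image stays in the cone; likewise for \<open>v\<close>.\<close>
  define u v where "u = ((\<integral>x. M * g' x - g x \<partial>\<mu>)) / ?s'" and "v = (\<integral>x. g x - m' * g' x \<partial>\<mu>) / ?s'"
  note int = Gcone_integrable[OF G(1)] Gcone_integrable[OF G(2)]
  have uv: "0 \<le> u" "0 \<le> v"
    unfolding u_def v_def using Gcone_integral_nonneg[OF h(1)] Gcone_integral_nonneg[OF h(2)] s by simp_all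
  have uv_sum: "u + v = M - m'"
    unfolding u_def v_def using int s by (simp add: field_simps)
  have pos_a: "0 < m' + \<theta> * v"
    using h(3) \<theta>(1) uv(2) by (simp add: add_pos_nonneg)
  have "\<theta> * u + \<theta> * v \<le> u + v"
    using \<theta> uv by (intro add_mono mult_left_le_one_le) simp_all
  then have pos_b: "0 < M - \<theta> * u"
    using pos_a uv_sum by linarith
  have "(\<lambda>x. (M - \<theta> * u) * \<Phi> g' x - 1 * \<Phi> g x) \<in> G"
  proof (rule sinkhorn_comb_in_Gcone[OF g g' h(1) G(2)])
    show "(M - \<theta> * u) * g' x - 1 * g x = 1 * (M * g' x - g x) - (\<theta> * u) * g' x" for x
      by (simp add: algebra_simps)
    show "12 * E * (\<theta> * u * ?s') \<le> 1 * (\<integral>x. M * g' x - g x \<partial>\<mu>)"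
      using s E_ge_1 by (simp add: \<theta>_def u_def)
  qed (use \<theta> uv in simp_all)
  then have upper: "(\<lambda>x. (M - \<theta> * u) * \<Phi> g' x - \<Phi> g x) \<in> G"
    by simp
  \<comment> \<open>Both coefficients are negated, because the comparison is phrased for a multiple
    of \<open>\<Phi> g'\<close> minus one of \<open>\<Phi> g\<close>.\<close>
  have "(\<lambda>x. (- (m' + \<theta> * v)) * \<Phi> g' x - (- 1) * \<Phi> g x) \<in> G"
  proof (rule sinkhorn_comb_in_Gcone[OF g g' h(2) G(2)])
    show "(- (m' + \<theta> * v)) * g' x - (- 1) * g x = 1 * (g x - m' * g' x) - (\<theta> * v) * g' x" for x
      by (simp add: algebra_simps)
    show "12 * E * (\<theta> * v * ?s') \<le> 1 * (\<integral>x. g x - m' * g' x \<partial>\<mu>)"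
      using s E_ge_1 by (simp add: \<theta>_def v_def)
  qed (use \<theta> uv in simp_all)
  moreover have "(\<lambda>x. (- (m' + \<theta> * v)) * \<Phi> g' x - (- 1) * \<Phi> g x) = (\<lambda>x. \<Phi> g x - (m' + \<theta> * v) * \<Phi> g' x)"
    by (simp add: fun_eq_iff algebra_simps)
  ultimately have lower: "(\<lambda>x. \<Phi> g x - (m' + \<theta> * v) * \<Phi> g' x) \<in> G"
    by simp
  have "?L \<le> ereal (ln ((M - \<theta> * u) / (m' + \<theta> * v)))"
    by (rule hilbert_dist_le[OF \<Phi> pos_a pos_b upper lower])
  also have "\<dots> \<le> ereal (ln ((1 - \<theta>) * t + \<theta>))"
  proof -
    have "(M - \<theta> * u) / (m' + \<theta> * v) \<le> (1 - \<theta>) * t + \<theta>"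
      unfolding t_def by (rule ratio_shrink_le[OF h(3,4) uv uv_sum \<theta>(1,2)])
    then show ?thesis
      using divide_pos_pos[OF pos_b pos_a] by simp
  qed
  finally have shrink: "?L \<le> ereal (ln ((1 - \<theta>) * t + \<theta>))" .

  \<comment> \<open>Comparing \<open>g'\<close> and \<open>g\<close> directly, without
    \<open>M\<close> and \<open>m'\<close>, gives a bound on the image distance that does not
    involve \<open>t\<close>.\<close>
  have "(\<lambda>x. (12 * E * ?s / ?s') * \<Phi> g' x - 1 * \<Phi> g x) \<in> G"
  proof (rule sinkhorn_comb_in_Gcone[OF g g' G(2) G(1)])
    show "(12 * E * ?s / ?s') * g' x - 1 * g x = (12 * E * ?s / ?s') * g' x - 1 * g x" for x
      by (rule refl)
    show "12 * E * (1 * ?s) \<le> 12 * E * ?s / ?s' * ?s'"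
      using s by simp
  qed (use s E_ge_1 in simp_all)
  then have upper: "(\<lambda>x. (12 * E * ?s / ?s') * \<Phi> g' x - \<Phi> g x) \<in> G"
    by simp
  have "(\<lambda>x. (- (?s / ?s' / (12 * E))) * \<Phi> g' x - (- 1) * \<Phi> g x) \<in> G"
  proof (rule sinkhorn_comb_in_Gcone[OF g g' G(1) G(2)])
    show "(- (?s / ?s' / (12 * E))) * g' x - (- 1) * g x = 1 * g x - (?s / ?s' / (12 * E)) * g' x" for x
      by simp
    show "12 * E * (?s / ?s' / (12 * E) * ?s') \<le> 1 * ?s"
      using s E_ge_1 by simp
  qed (use s E_ge_1 in simp_all)
  moreover have "(\<lambda>x. (- (?s / ?s' / (12 * E))) * \<Phi> g' x - (- 1) * \<Phi> g x)
      = (\<lambda>x. \<Phi> g x - (?s / ?s' / (12 * E)) * \<Phi> g' x)"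
    by (simp add: fun_eq_iff algebra_simps)
  ultimately have lower: "(\<lambda>x. \<Phi> g x - (?s / ?s' / (12 * E)) * \<Phi> g' x) \<in> G"
    by simp
  have "?L \<le> ereal (ln (12 * E * ?s / ?s' / (?s / ?s' / (12 * E))))"
    using s E_ge_1 by (intro hilbert_dist_le[OF \<Phi> _ _ upper lower]) simp_all
  also have "12 * E * ?s / ?s' / (?s / ?s' / (12 * E)) = (12 * E)\<^sup>2"
    using s E_ge_1 by (simp add: power2_eq_square)
  finally have diameter: "?L \<le> ereal (ln ((12 * E)\<^sup>2))" .

  have ln_t: "0 \<le> ln t"
    using t by simp
  show ?thesis
  proof (cases "t \<le> (12 * E) ^ 4")
    case True
    have "ln ((1 - \<theta>) * t + \<theta>) \<le> (1 - \<theta> / (12 * E) ^ 4) * ln t"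
      using t True \<theta>(1,2) by (rule ln_affine_interpolation_le)
    also have "\<dots> \<le> \<kappa> * ln t"
      unfolding \<theta>_def by (rule mult_right_mono[OF \<kappa>(2) ln_t])
    finally show ?thesis
      using order_trans[OF shrink] unfolding dist times_ereal.simps by simp
  next
    case False
    then have "ln ((12 * E) ^ 4) \<le> ln t"
      using E_ge_1 t by (subst ln_le_cancel_iff) simp_all
    moreover have "ln ((12 * E) ^ 4) = 2 * ln ((12 * E)\<^sup>2)"
      using E_ge_1 by (subst (1 2) ln_realpow) simp_all
    ultimately have "ln ((12 * E)\<^sup>2) \<le> 1 / 2 * ln t"
      by linarith
    also have "\<dots> \<le> \<kappa> * ln t"
      by (rule mult_right_mono[OF \<kappa>(1) ln_t])
    finally show ?thesis
      using order_trans[OF diameter] unfolding dist times_ereal.simps by simp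
  qed
qed

end

section \<open>Kernels of subexponential decay and light tails\<close>

lemma sums_telescope_inverse:
  fixes m :: real
  assumes "0 < m"
  shows "(\<lambda>n. 1 / ((m + real n) * (m + real n + 1))) sums (1 / m)"
proof -
  have "(\<lambda>n. 1 / (m + real n)) \<longlonglongrightarrow> 0"
    by real_asymp
  from telescope_sums'[OF this] have "(\<lambda>n. 1 / (m + real n) - 1 / (m + real (Suc n))) sums (1 / m)"
    by simp
  moreover have "1 / (m + real n) - 1 / (m + real (Suc n)) = 1 / ((m + real n) * (m + real n + 1))" for n
    using assms by (simp add: field_simps add_pos_nonneg add_nonneg_eq_0_iff)
  ultimately show ?thesis
    by simp
qed

text \<open>The outside of the ball is cut into shells of width 1. On the shell starting at
  \<open>r\<close> the squared weight is at most \<open>exp (2 * (r + 1) powr p)\<close>, and the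
  tail at \<open>r\<close> controls the mass. Of the exponent 5, two units pay for that weight and
  three remain to produce \<open>exp (- 3 * m powr p)\<close>, the cube needed for
  \<open>\<tau>\<close>; the factors \<open>1 / (r * (r + 1))\<close> telescope to
  \<open>1 / m\<close>, which is left to absorb constants.\<close>

lemma exp_weighted_tail:
  fixes M :: "'a::polish_space measure" and u :: "'a \<Rightarrow> real" and \<gamma> :: "real \<Rightarrow> real"
    and x0 :: 'a and m p C :: real
  defines "w \<equiv> \<lambda>x. exp (max m (dist x0 x) powr p)"
  assumes sets_M [measurable_cong]: "sets M = sets borel"
    and u: "integrable M u" "\<And>x. 0 \<le> u x" and m: "1 \<le> m" and "0 < p" "0 \<le> C"
    and tail: "\<And>r. m \<le> r \<Longrightarrow> (\<integral>x\<in>- cball x0 r. u x \<partial>M) \<le> \<gamma> r * C"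
    and decay: "\<And>r. m \<le> r \<Longrightarrow> exp (5 * (r + 1) powr p) * \<gamma> r \<le> 1 / (r * (r + 1))"
  shows "integrable M (\<lambda>x. u x * (w x)\<^sup>2)"
    and "(\<integral>x\<in>- cball x0 m. u x * (w x)\<^sup>2 \<partial>M) \<le> C * exp (- 3 * m powr p) / m"
proof -
  have [measurable]: "u \<in> borel_measurable borel" "w \<in> borel_measurable borel"
    using borel_measurable_integrable[OF u(1)] measurable_cong_sets[OF sets_M refl, of "borel :: real measure"]
    unfolding w_def by simp_all
  have cball_sets [measurable]: "- cball x0 r \<in> sets borel" "cball x0 r \<in> sets borel" for r
    by auto
  have space_M [simp]: "space M = UNIV"
    using sets_eq_imp_space_eq[OF sets_M] by simp
  let ?B = "cball x0 m"
  define D where "D = exp (- 3 * m powr p)"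
  define s where "s = (\<lambda>n x. u x * exp (2 * (m + real n + 1) powr p) * indicator (- cball x0 (m + real n)) x)"
  have s_meas [measurable]: "s n \<in> borel_measurable M" for n
    unfolding s_def by measurable
  have s_nonneg: "0 \<le> s n x" for n x
    unfolding s_def using u(2) by simp
  have pointwise: "ennreal (indicator (- ?B) x * (u x * (w x)\<^sup>2)) \<le> (\<Sum>n. ennreal (s n x))" for x
  proof (cases "x \<in> ?B")
    case False
    then have d: "m < dist x0 x"
      by simp
    \<comment> \<open>Shells are open at the inner and closed at the outer end, so \<open>x\<close>
      is outside the closed ball of radius \<open>m + real n\<close> even if its distance is
      \<open>m\<close> plus an integer; a plain floor would fail there.\<close>
    define n where "n = nat (\<lceil>dist x0 x - m\<rceil> - 1)"
    have n: "m + real n < dist x0 x" "dist x0 x \<le> m + real n + 1"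
      unfolding n_def using d by linarith+
    have "(w x)\<^sup>2 = exp (2 * dist x0 x powr p)"
      using d by (simp add: w_def exp_double)
    also have "\<dots> \<le> exp (2 * (m + real n + 1) powr p)"
      using n d \<open>0 < p\<close> by (simp add: powr_mono2)
    finally have "indicator (- ?B) x * (u x * (w x)\<^sup>2) \<le> s n x"
      unfolding s_def using u(2)[of x] n False by (simp add: mult_left_mono)
    then have "ennreal (indicator (- ?B) x * (u x * (w x)\<^sup>2)) \<le> ennreal (s n x)"
      by (rule ennreal_leI)
    also have "\<dots> \<le> (\<Sum>n. ennreal (s n x))"
      using sum_le_suminf[of "\<lambda>n. ennreal (s n x)" "{n}"] by simp
    finally show ?thesis .
  qed simp
  have s_int: "(\<integral>\<^sup>+x. ennreal (s n x) \<partial>M) \<le> ennreal (C * D * (1 / ((m + real n) * (m + real n + 1))))" for n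
  proof -
    define r where "r = m + real n"
    have r: "m \<le> r"
      by (simp add: r_def)
    note ui = set_integrable_Compl(2)[OF u(1), of "cball x0 r"]
    have ui': "set_integrable M (- cball x0 r) u"
      by (rule ui) (simp add: sets_M)
    have s_eq: "s n = (\<lambda>x. exp (2 * (r + 1) powr p) * (indicator (- cball x0 r) x *\<^sub>R u x))"
      by (simp add: s_def r_def fun_eq_iff)
    have si: "integrable M (s n)"
      unfolding s_eq using ui' unfolding set_integrable_def by simp
    have "(\<integral>x. s n x \<partial>M) = exp (2 * (r + 1) powr p) * (\<integral>x\<in>- cball x0 r. u x \<partial>M)"
      unfolding s_eq set_lebesgue_integral_def by simp
    also have "\<dots> \<le> exp (2 * (r + 1) powr p) * (\<gamma> r * C)"
      by (intro mult_left_mono tail r) simp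
    also have "exp (2 * (r + 1) powr p) = exp (- 3 * (r + 1) powr p) * exp (5 * (r + 1) powr p)"
      by (simp flip: exp_add)
    also have "exp (- 3 * (r + 1) powr p) * exp (5 * (r + 1) powr p) * (\<gamma> r * C)
        = exp (- 3 * (r + 1) powr p) * C * (exp (5 * (r + 1) powr p) * \<gamma> r)"
      by simp
    also have "\<dots> \<le> exp (- 3 * (r + 1) powr p) * C * (1 / (r * (r + 1)))"
      using \<open>0 \<le> C\<close> by (intro mult_left_mono decay r) simp
    also have "\<dots> \<le> D * C * (1 / (r * (r + 1)))"
    proof (intro mult_right_mono \<open>0 \<le> C\<close>)
      have "m powr p \<le> (r + 1) powr p"
        using m r \<open>0 < p\<close> by (intro powr_mono2) auto
      then show "exp (- 3 * (r + 1) powr p) \<le> D"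
        by (simp add: D_def)
      show "0 \<le> 1 / (r * (r + 1))"
        using m r by simp
    qed
    finally have "(\<integral>x. s n x \<partial>M) \<le> C * D * (1 / (r * (r + 1)))"
      by (simp add: mult.commute)
    then show ?thesis
      using s_nonneg by (subst nn_integral_eq_integral[OF si]) (simp_all add: r_def ennreal_leI)
  qed
  have sums: "(\<lambda>n. C * D * (1 / ((m + real n) * (m + real n + 1)))) sums (C * D * (1 / m))"
    using m by (intro sums_mult sums_telescope_inverse) simp
  have "(\<integral>\<^sup>+x. ennreal (indicator (- ?B) x * (u x * (w x)\<^sup>2)) \<partial>M) \<le> (\<integral>\<^sup>+x. (\<Sum>n. ennreal (s n x)) \<partial>M)"
    by (intro nn_integral_mono pointwise)
  also have "\<dots> = (\<Sum>n. \<integral>\<^sup>+x. ennreal (s n x) \<partial>M)"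
    by (intro nn_integral_suminf) measurable
  also have "\<dots> \<le> (\<Sum>n. ennreal (C * D * (1 / ((m + real n) * (m + real n + 1)))))"
    by (intro suminf_le s_int) auto
  also have "\<dots> = ennreal (C * D * (1 / m))"
  proof (rule suminf_ennreal_eq[OF _ sums])
    show "0 \<le> C * D * (1 / ((m + real n) * (m + real n + 1)))" for n
      using m \<open>0 \<le> C\<close> by (simp add: D_def)
  qed
  finally have nn: "(\<integral>\<^sup>+x. ennreal (indicator (- ?B) x * (u x * (w x)\<^sup>2)) \<partial>M) \<le> ennreal (C * D * (1 / m))" .
  have CD: "0 \<le> C * D * (1 / m)"
    using m \<open>0 \<le> C\<close> by (simp add: D_def)
  have out: "integrable M (\<lambda>x. indicator (- ?B) x * (u x * (w x)\<^sup>2))"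
  proof (rule integrableI_nonneg)
    show "(\<integral>\<^sup>+x. ennreal (indicator (- ?B) x * (u x * (w x)\<^sup>2)) \<partial>M) < \<infinity>"
      using nn by (rule order.strict_trans1) simp
    show "(\<lambda>x. indicator (- ?B) x * (u x * (w x)\<^sup>2)) \<in> borel_measurable M"
      by measurable
    show "AE x in M. 0 \<le> indicator (- ?B) x * (u x * (w x)\<^sup>2)"
      using u(2) by (intro AE_I2) simp
  qed
  have "(\<integral>x\<in>- ?B. u x * (w x)\<^sup>2 \<partial>M) \<le> C * D * (1 / m)"
    unfolding set_lebesgue_integral_def real_scaleR_def
  proof (subst integral_eq_nn_integral)
    show "(\<lambda>x. indicator (- ?B) x * (u x * (w x)\<^sup>2)) \<in> borel_measurable M"
      by measurable
    show "AE x in M. 0 \<le> indicator (- ?B) x * (u x * (w x)\<^sup>2)"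
      using u(2) by (intro AE_I2) simp
    show "enn2real (\<integral>\<^sup>+x. ennreal (indicator (- ?B) x * (u x * (w x)\<^sup>2)) \<partial>M) \<le> C * D * (1 / m)"
      using enn2real_mono[OF nn] CD by simp
  qed
  then show "(\<integral>x\<in>- ?B. u x * (w x)\<^sup>2 \<partial>M) \<le> C * exp (- 3 * m powr p) / m"
    by (simp add: D_def)
  have "integrable M (\<lambda>x. indicator (- ?B) x * (u x * (w x)\<^sup>2) + (exp (m powr p))\<^sup>2 * (indicator ?B x *\<^sub>R u x))"
    using out set_integrable_Compl(1)[OF u(1), of ?B] unfolding set_integrable_def
    by (intro Bochner_Integration.integrable_add integrable_mult_right) (simp_all add: sets_M)
  also have "(\<lambda>x. indicator (- ?B) x * (u x * (w x)\<^sup>2) + (exp (m powr p))\<^sup>2 * (indicator ?B x *\<^sub>R u x))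
      = (\<lambda>x. u x * (w x)\<^sup>2)"
    by (auto simp: fun_eq_iff indicator_def w_def max_def)
  finally show "integrable M (\<lambda>x. u x * (w x)\<^sup>2)" .
qed

theorem theorem5p5:
  fixes \<mu> \<nu> :: "'a::polish_space measure" and x0 :: 'a
    and c :: "'a \<Rightarrow> 'a \<Rightarrow> real" and \<epsilon> p \<delta> :: real
  assumes "prob_space \<mu>" and "prob_space \<nu>"
    and "sets \<mu> = sets borel" and "sets \<nu> = sets borel"
    and "\<epsilon> > 0"
    and "\<forall>x y. 0 \<le> c x y"
    and "case_prod c \<in> borel_measurable (borel \<Otimes>\<^sub>M borel)"
    and "(\<integral>\<^sup>+ z. ennreal (case_prod c z) \<partial>(\<mu> \<Otimes>\<^sub>M \<nu>)) < \<infinity>"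
    and "p > 0" and "\<delta> > 0"
    and "((\<lambda>r. (SUP z\<in>cball x0 r \<times> cball x0 r. ereal (case_prod c z)) / ereal (r powr p))
           \<longlongrightarrow> 0) at_top"
    and "((\<lambda>r. max (measure \<mu> (- cball x0 r)) (measure \<nu> (- cball x0 r))
                / exp (- (r powr (p + \<delta>)))) \<longlongrightarrow> 0) at_top"
  shows "\<exists>m_low>0. \<forall>m\<ge>m_low. \<exists>\<kappa>. 0 < \<kappa> \<and> \<kappa> < 1 \<and>
     (let K = (\<lambda>x y. exp (- c x y / \<epsilon>));
          \<alpha> = (\<lambda>r. exp (- (r powr (p + \<delta> / 2))));
          G = Gcone \<mu> x0 \<alpha> \<alpha> m m;
          \<Phi> = sinkhorn_map K \<mu> \<nu>;
          Init = {g \<in> G. \<not> (AE x in \<mu>. g x = 0) \<and> (AE x in \<mu>. 0 \<le> g x)};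
          Orbit = {(\<Phi> ^^ n) g | n g. g \<in> Init}
      in \<forall>g\<in>Orbit. \<forall>g'\<in>Orbit.
           hilbert_dist G \<mu> (\<Phi> g) (\<Phi> g') \<le> ereal \<kappa> * hilbert_dist G \<mu> g g')"
proof -
  \<comment> \<open>\<open>q\<close> lies strictly between \<open>p\<close> and
    \<open>p + \<delta>\<close>: the threshold \<open>r1\<close> uses the gap below it,
    \<open>r2\<close> the gap above.\<close>
  define q where "q = p + \<delta> / 2"
  have p: "0 < p" and d: "0 < \<delta>" and \<epsilon>: "0 < \<epsilon>"
    using assms by blast+
  have "eventually (\<lambda>r. exp (5 * (r + 1) powr p) * exp (- (r powr q)) \<le> 1 / (r * (r + 1))) at_top"
    unfolding q_def using p d by real_asymp
  then obtain r1 where r1: "\<And>r. r1 \<le> r \<Longrightarrow> exp (5 * (r + 1) powr p) * exp (- (r powr q)) \<le> 1 / (r * (r + 1))"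
    unfolding eventually_at_top_linorder by blast
  \<comment> \<open>In exponential form: \<open>exp (- (r powr (p + \<delta>)))\<close> beats
    \<open>\<alpha> r\<close> by the factor \<open>256 * exp (r powr p) ^ 3\<close>, which becomes
    \<open>1 / \<tau>\<close> at \<open>r = m\<close>.\<close>
  have "eventually (\<lambda>r. 3 * r powr p + r powr q + ln 256 \<le> r powr (p + \<delta>)) at_top"
    unfolding q_def using p d by real_asymp
  then obtain r2 where r2: "\<And>r. r2 \<le> r \<Longrightarrow> 3 * r powr p + r powr q + ln 256 \<le> r powr (p + \<delta>)"
    unfolding eventually_at_top_linorder by blast
  have "eventually (\<lambda>r. (SUP z\<in>cball x0 r \<times> cball x0 r. ereal (case_prod c z)) / ereal (r powr p) < ereal \<epsilon>) at_top"
    using assms(11) \<epsilon> by (intro order_tendstoD(2)[where y = "0 :: ereal"]) auto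
  then obtain r3 where r3: "\<And>r. r3 \<le> r \<Longrightarrow>
      (SUP z\<in>cball x0 r \<times> cball x0 r. ereal (case_prod c z)) / ereal (r powr p) < ereal \<epsilon>"
    unfolding eventually_at_top_linorder by blast
  have "eventually (\<lambda>r. max (measure \<mu> (- cball x0 r)) (measure \<nu> (- cball x0 r))
      / exp (- (r powr (p + \<delta>))) < 1) at_top"
    using assms(12) by (rule order_tendstoD(2)) simp
  then obtain r4 where r4: "\<And>r. r4 \<le> r \<Longrightarrow>
      max (measure \<mu> (- cball x0 r)) (measure \<nu> (- cball x0 r)) / exp (- (r powr (p + \<delta>))) < 1"
    unfolding eventually_at_top_linorder by blast

  define K \<alpha> where "K = (\<lambda>x y. exp (- c x y / \<epsilon>))" and "\<alpha> = (\<lambda>r. exp (- (r powr q)))"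
  \<comment> \<open>Used with \<open>r = max m (dist x0 y)\<close>, a radius whose ball contains
    \<open>y\<close> and every point of the ball of radius \<open>m\<close>; the weight
    \<open>e\<close> takes its form from this.\<close>
  have K_ge: "1 / exp (r powr p) \<le> K x y"
    if r: "max 1 r3 \<le> r" and xy: "x \<in> cball x0 r" "y \<in> cball x0 r" for r x y
  proof -
    have rp: "0 < r powr p"
      using r by simp
    have "ereal (case_prod c (x, y)) / ereal (r powr p)
        \<le> (SUP z\<in>cball x0 r \<times> cball x0 r. ereal (case_prod c z)) / ereal (r powr p)"
      using xy rp by (intro ereal_divide_right_mono SUP_upper) auto
    also have "\<dots> < ereal \<epsilon>"
      using r by (intro r3) simp
    finally have "c x y / r powr p < \<epsilon>"
      using rp by simp
    then have "c x y / \<epsilon> \<le> r powr p"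
      using rp \<epsilon> by (simp add: field_simps)
    then have "exp (- (r powr p)) \<le> K x y"
      by (simp add: K_def)
    then show ?thesis
      by (simp add: exp_minus inverse_eq_divide)
  qed
  have tail: "measure \<mu> (- cball x0 r) \<le> 1 / (256 * exp (r powr p) ^ 3) * \<alpha> r"
    "measure \<nu> (- cball x0 r) \<le> 1 / (256 * exp (r powr p) ^ 3) * \<alpha> r"
    if "max r2 r4 \<le> r" for r
  proof -
    have "max (measure \<mu> (- cball x0 r)) (measure \<nu> (- cball x0 r)) \<le> exp (- (r powr (p + \<delta>)))"
      using r4[of r] that by (simp add: divide_less_eq)
    also have "\<dots> \<le> exp (- (3 * r powr p + r powr q + ln 256))"
      using r2[of r] that by simp
    also have "\<dots> = 1 / (256 * exp (r powr p) ^ 3) * \<alpha> r"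
      by (simp add: \<alpha>_def exp_add exp_minus exp_diff field_simps flip: exp_of_nat_mult)
    finally show "measure \<mu> (- cball x0 r) \<le> 1 / (256 * exp (r powr p) ^ 3) * \<alpha> r"
      "measure \<nu> (- cball x0 r) \<le> 1 / (256 * exp (r powr p) ^ 3) * \<alpha> r"
      by simp_all
  qed

  \<comment> \<open>512 is twice the 256 in \<open>\<tau>\<close>. The 2 comes from adding the tails
    of the positive and the negative part of a test function, and the factor \<open>1 / m\<close> of
    the shell estimate removes both.\<close>
  define m_low where "m_low = Max {512, r1, r2, r3, r4}"
  have m_low: "512 \<le> m_low" "r1 \<le> m_low" "r2 \<le> m_low" "r3 \<le> m_low" "r4 \<le> m_low"
    unfolding m_low_def by (intro Max_ge; simp)+
  have main: "\<exists>\<kappa>. 0 < \<kappa> \<and> \<kappa> < 1 \<and>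
      (\<forall>g\<in>{(sinkhorn_map K \<mu> \<nu> ^^ n) g | n g. g \<in> {g \<in> Gcone \<mu> x0 \<alpha> \<alpha> m m.
          \<not> (AE x in \<mu>. g x = 0) \<and> (AE x in \<mu>. 0 \<le> g x)}}.
        \<forall>g'\<in>{(sinkhorn_map K \<mu> \<nu> ^^ n) g | n g. g \<in> {g \<in> Gcone \<mu> x0 \<alpha> \<alpha> m m.
          \<not> (AE x in \<mu>. g x = 0) \<and> (AE x in \<mu>. 0 \<le> g x)}}.
        hilbert_dist (Gcone \<mu> x0 \<alpha> \<alpha> m m) \<mu> (sinkhorn_map K \<mu> \<nu> g) (sinkhorn_map K \<mu> \<nu> g')
          \<le> ereal \<kappa> * hilbert_dist (Gcone \<mu> x0 \<alpha> \<alpha> m m) \<mu> g g')"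
    if m_ge: "m_low \<le> m" for m
  proof -
    from m_ge m_low have m: "512 \<le> m" "r1 \<le> m" "r2 \<le> m" "r3 \<le> m" "r4 \<le> m"
      by linarith+
    define E \<tau> e where "E = exp (m powr p)" and "\<tau> = 1 / (256 * E ^ 3)"
      and "e = (\<lambda>x. exp (max m (dist x0 x) powr p))"
    have E: "1 \<le> E"
      by (simp add: E_def)
    have \<tau>: "0 < \<tau>"
      using E by (simp add: \<tau>_def)
    have weight: "2 * C * exp (- 3 * m powr p) / m \<le> \<tau> * C" if "0 \<le> C" for C
    proof -
      have "exp (- 3 * m powr p) = 256 * \<tau>"
        by (simp add: \<tau>_def E_def exp_minus inverse_eq_divide flip: exp_of_nat_mult)
      then have "2 * C * exp (- 3 * m powr p) / m = \<tau> * C * (512 / m)"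
        by simp
      also have "\<dots> \<le> \<tau> * C * 1"
        using m \<tau> that by (intro mult_left_mono) simp_all
      finally show ?thesis
        by simp
    qed
    have decay: "exp (5 * (r + 1) powr p) * \<alpha> r \<le> 1 / (r * (r + 1))" if "m \<le> r" for r
      unfolding \<alpha>_def using that m by (intro r1) simp
    have tail': "measure M (- cball x0 r) \<le> \<tau> * \<alpha> r" if "m \<le> r" "M = \<mu> \<or> M = \<nu>" for M r
    proof -
      have "m powr p \<le> r powr p"
        using that m p by (intro powr_mono2) auto
      then have "exp (m powr p) ^ 3 \<le> exp (r powr p) ^ 3"
        by (intro power_mono) simp_all
      then have "1 / (256 * exp (r powr p) ^ 3) \<le> \<tau>"
        unfolding \<tau>_def E_def by (intro divide_left_mono mult_pos_pos) simp_all
      then have "1 / (256 * exp (r powr p) ^ 3) * \<alpha> r \<le> \<tau> * \<alpha> r"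
        by (rule mult_right_mono) (simp add: \<alpha>_def)
      then show ?thesis
        using tail[of r] that m by auto
    qed
    have \<tau>_le: "\<tau> \<le> 1"
    proof -
      have "1 \<le> E ^ 3"
        using E by (rule one_le_power)
      then show ?thesis
        unfolding \<tau>_def by (subst divide_le_eq_1_pos) linarith+
    qed
    have e2: "integrable M (\<lambda>x. (e x)\<^sup>2)" "(\<integral>x\<in>- cball x0 m. (e x)\<^sup>2 \<partial>M) \<le> \<tau>"
      if M: "M = \<mu> \<or> M = \<nu>" for M
    proof -
      have sets_M: "sets M = sets borel" and prob_M: "prob_space M"
        using M assms by auto
      interpret prob_space M by (rule prob_M)
      have tail1: "(\<integral>x\<in>- cball x0 r. 1 \<partial>M) \<le> \<alpha> r * 1" if r: "m \<le> r" for r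
      proof -
        have "(\<integral>x\<in>- cball x0 r. 1 \<partial>M) = measure M (- cball x0 r)"
          using sets_eq_imp_space_eq[OF sets_M] by (simp add: set_lebesgue_integral_def)
        also have "\<dots> \<le> \<tau> * \<alpha> r"
          by (rule tail'[OF r M])
        also have "\<dots> \<le> 1 * \<alpha> r"
          using \<tau>_le by (rule mult_right_mono) (simp add: \<alpha>_def)
        finally show ?thesis
          by simp
      qed
      note w = exp_weighted_tail[where m = m and u = "\<lambda>_. 1", OF sets_M _ _ _ p _ tail1 decay]
      show "integrable M (\<lambda>x. (e x)\<^sup>2)"
        using w(1) m by (simp add: e_def)
      have "(\<integral>x\<in>- cball x0 m. (e x)\<^sup>2 \<partial>M) \<le> exp (- 3 * m powr p) / m"
        using w(2) m by (simp add: e_def)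
      also have "\<dots> \<le> 2 * 1 * exp (- 3 * m powr p) / m"
        using m by (simp add: divide_right_mono)
      also have "\<dots> \<le> \<tau> * 1"
        by (rule weight) simp
      finally show "(\<integral>x\<in>- cball x0 m. (e x)\<^sup>2 \<partial>M) \<le> \<tau>"
        by simp
    qed
    have F: "integrable \<mu> (\<lambda>x. \<bar>f x\<bar> * (e x)\<^sup>2)"
      "(\<integral>x\<in>- cball x0 m. \<bar>f x\<bar> * (e x)\<^sup>2 \<partial>\<mu>) \<le> \<tau> * (\<integral>x. f x \<partial>\<mu>)"
      if f: "f \<in> Fcone \<mu> x0 \<alpha> \<alpha> m m" for f
    proof -
      interpret prob_space \<mu> by (rule assms(1))
      let ?I = "\<integral>x. f x \<partial>\<mu>"
      have Fcone_tails: "\<forall>r\<ge>m. (\<integral>x\<in>- cball x0 r. max (f x) 0 \<partial>\<mu>) \<le> \<alpha> r * ?I"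
          "\<forall>r\<ge>m. (\<integral>x\<in>- cball x0 r. max (- f x) 0 \<partial>\<mu>) \<le> \<alpha> r * ?I"
        and f_meas: "f \<in> borel_measurable \<mu>" and f_sq: "integrable \<mu> (\<lambda>x. (f x)\<^sup>2)"
        using f unfolding Fcone_def mem_Collect_eq by - (elim conjE, assumption)+
      note pos = Fcone_tails(1)[rule_format] and neg = Fcone_tails(2)[rule_format]
      have int: "integrable \<mu> f"
        by (rule square_integrable_imp_integrable[OF f_meas f_sq])
      have cball_sets: "cball x0 r \<in> sets \<mu>" for r
        by (simp add: assms(3))
      have "0 \<le> (\<integral>x\<in>- cball x0 m. max (f x) 0 \<partial>\<mu>)"
        unfolding set_lebesgue_integral_def by (intro Bochner_Integration.integral_nonneg) simp
      then have "0 \<le> \<alpha> m * ?I"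
        using pos[of m] by linarith
      then have I: "0 \<le> ?I"
        by (simp add: \<alpha>_def zero_le_mult_iff)
      have tailf: "(\<integral>x\<in>- cball x0 r. \<bar>f x\<bar> \<partial>\<mu>) \<le> \<alpha> r * (2 * ?I)" if r: "m \<le> r" for r
      proof -
        have "(\<integral>x\<in>- cball x0 r. \<bar>f x\<bar> \<partial>\<mu>) = (\<integral>x\<in>- cball x0 r. max (f x) 0 + max (- f x) 0 \<partial>\<mu>)"
          unfolding set_lebesgue_integral_def by (intro Bochner_Integration.integral_cong) auto
        also have "\<dots> = (\<integral>x\<in>- cball x0 r. max (f x) 0 \<partial>\<mu>) + (\<integral>x\<in>- cball x0 r. max (- f x) 0 \<partial>\<mu>)"
          using int cball_sets by (intro set_integral_add set_integrable_Compl) auto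
        finally show ?thesis
          using pos[OF r] neg[OF r] by linarith
      qed
      note w = exp_weighted_tail[where m = m and u = "\<lambda>x. \<bar>f x\<bar>", OF assms(3) integrable_abs[OF int] _ _ p _ tailf decay]
      show "integrable \<mu> (\<lambda>x. \<bar>f x\<bar> * (e x)\<^sup>2)"
        using w(1) m I by (simp add: e_def)
      show "(\<integral>x\<in>- cball x0 m. \<bar>f x\<bar> * (e x)\<^sup>2 \<partial>\<mu>) \<le> \<tau> * ?I"
        using w(2) m I weight[OF I] by (simp add: e_def)
    qed
    interpret sinkhorn_cone \<mu> \<nu> K x0 \<alpha> m E \<tau> e
    proof (rule sinkhorn_cone.intro)
      show "prob_space \<mu>" "prob_space \<nu>" "sets \<mu> = sets borel" "sets \<nu> = sets borel"
        by (fact assms)+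
      have [measurable]: "(\<lambda>z. c (fst z) (snd z)) \<in> borel_measurable (borel \<Otimes>\<^sub>M borel)"
        using assms(7) by (simp add: case_prod_unfold)
      show "(\<lambda>(x, y). K x y) \<in> borel_measurable (borel \<Otimes>\<^sub>M borel)"
        unfolding K_def case_prod_unfold by measurable
      show "0 < K x y" "K x y \<le> 1" for x y
        using assms(6) \<epsilon> by (simp_all add: K_def)
      show "1 \<le> E" "0 < \<tau>"
        by fact+
      show "\<tau> * (256 * E ^ 3) \<le> 1"
        using E by (simp add: \<tau>_def)
      show "e \<in> borel_measurable borel"
        unfolding e_def by measurable
      show "e x = E" if "x \<in> cball x0 m" for x
        using that by (simp add: e_def E_def max_def)
      show "E \<le> e x" for x
        using m p by (simp add: e_def E_def powr_mono2)
      show "1 / e y \<le> K x y" if "x \<in> cball x0 m" for x y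
        unfolding e_def using that m by (intro K_ge) auto
      show "1 / e x \<le> K x y" if "y \<in> cball x0 m" for x y
        unfolding e_def using that m by (intro K_ge) auto
      show "0 \<le> \<alpha> r" "\<alpha> r \<le> 1" for r
        by (simp_all add: \<alpha>_def)
      show "measure \<mu> (- cball x0 r) \<le> \<tau> * \<alpha> r" if "m \<le> r" for r
        using that by (intro tail') simp_all
      show "integrable \<mu> (\<lambda>x. (e x)\<^sup>2)" "integrable \<nu> (\<lambda>x. (e x)\<^sup>2)"
        "(\<integral>x\<in>- cball x0 m. (e x)\<^sup>2 \<partial>\<nu>) \<le> \<tau>"
        by (rule e2; simp)+
    qed (fact F)+
    \<comment> \<open>One value for each range of distances; it depends on the radius through
      \<open>E\<close> alone and so serves all orbits.\<close>
    define \<kappa> where "\<kappa> = max (1 / 2) (1 - 1 / (12 * E) / (12 * E) ^ 4)"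
    have orbit: "(\<Phi> ^^ n) g \<in> Gpos" if "g \<in> Gpos" for n g
    proof (induction n)
      case 0
      show ?case
        using that by (simp only: funpow_0)
    next
      case (Suc n)
      then show ?case
        unfolding funpow.simps comp_apply by (rule sinkhorn_Gpos)
    qed
    have contraction: "hilbert_dist G \<mu> (\<Phi> g) (\<Phi> g') \<le> ereal \<kappa> * hilbert_dist G \<mu> g g'"
      if g: "g \<in> {(\<Phi> ^^ n) g | n g. g \<in> Gpos}" and g': "g' \<in> {(\<Phi> ^^ n) g | n g. g \<in> Gpos}" for g g'
    proof (rule sinkhorn_contraction)
      have "x \<in> Gpos" if "x \<in> {(\<Phi> ^^ n) g | n g. g \<in> Gpos}" for x
      proof -
        from that have "\<exists>n g. x = (\<Phi> ^^ n) g \<and> g \<in> Gpos"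
          by (rule CollectD)
        then show ?thesis
          by (elim exE conjE) (simp only: orbit)
      qed
      from this[OF g] this[OF g'] show "g \<in> Gpos" "g' \<in> Gpos" .
    qed (simp_all only: \<kappa>_def max.cobounded1 max.cobounded2)
    have "0 < 1 / (12 * E) / (12 * E) ^ 4"
      using E by simp
    then have \<kappa>: "0 < \<kappa>" "\<kappa> < 1"
      unfolding \<kappa>_def by simp_all
    then show ?thesis
      by (intro exI[of _ \<kappa>] conjI ballI contraction)
  qed
  have "0 < m_low"
    using m_low by linarith
  then show ?thesis
    unfolding Let_def
    by (intro exI[of _ m_low] conjI allI impI main[unfolded K_def \<alpha>_def q_def])
qed

end
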